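(* In Pandora's Matching Problem, the Randomized Pandora Matching Algorithm achieves at least a $1/4$-approximation of the optimal welfare: for every instance, $\mathrm{Welfare}(\textsc{Alg}^{\text{rand}}) \ge \tfrac14 \mathrm{Welfare}(\textsc{Opt})$.
   Context: Pandora's Matching Problem. An instance consists of a finite undirected graph $G=(V,E)$, not necessarily bipartite, and, for each edge $\{i,j\}\in E$, two Pandora boxes: box $(i,j)$ with a known distribution $D_{ij}$ over $\mathbb{R}$ (with finite mean) and a known cost $c_{ij}\ge 0$, and box $(j,i)$ with $D_{ji}$ and $c_{ji}\ge 0$. The values $v_{ij}\sim D_{ij}$ are drawn independently over all boxes. An algorithm repeatedly chooses an unopened box $(i,j)$, pays $c_{ij}$ and observes $v_{ij}$; its choices may depend on everything observed so far (and on internal randomness). Eventually it stops and outputs a matching of $G$ consisting only of edges both of whose boxes have been opened. Let $\mathbb{I}_{ij}$ indicate that box $(i,j)$ was opened and $\mathbb{A}_{ij}=\mathbb{A}_{ji}$ indicate that $\{i,j\}$ is in the output matching. The welfare of an algorithm is $\mathrm{Welfare}=\mathbb{E}\big[\sum_{(i,j)}(\mathbb{A}_{ij}v_{ij}-\mathbb{I}_{ij}c_{ij})\big]$, the sum over all boxes. $\textsc{Opt}$ denotes a welfare-maximizing algorithm. Orientations and nested indices. An orientation $\mathcal{O}$ of $G$ is a set of ordered pairs containing, for each edge $\{i,j\}$, exactly one of $(i,j)$, $(j,i)$. For $(i,j)\in\mathcal{O}$ the edge is treated as a two-stage basket: stage 1 opens box $(i,j)$ (cost $c_{ij}$, reveals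 $v_{ij}$), stage 2 opens box $(j,i)$ (cost $c_{ji}$, reveals the total $v_{ij}+v_{ji}$), and advancing the basket once both boxes are open means adding $\{i,j\}$ to the matching. Its indices are defined by backward induction: $\sigma^{(3)}_{ij}=\kappa^{(3)}_{ij}=v_{ij}+v_{ji}$; $\sigma^{(2)}_{ij}$ is the function of $v_{ij}$ that solves $\mathbb{E}[(\kappa^{(3)}_{ij}-\sigma^{(2)}_{ij})^+\mid v_{ij}]=c_{ji}$, and $\kappa^{(2)}_{ij}=\min(\sigma^{(2)}_{ij},\kappa^{(3)}_{ij})$; $\sigma^{(1)}_{ij}$ is the real number solving $\mathbb{E}[(\kappa^{(2)}_{ij}-\sigma^{(1)}_{ij})^+]=c_{ij}$, and $\kappa^{(1)}_{ij}=\min(\sigma^{(1)}_{ij},\kappa^{(2)}_{ij})$. Here $(x)^+=\max(x,0)$. The current Weitzman index of the basket is $\sigma^{(1)}_{ij}$ if no box of the edge is open, $\sigma^{(2)}_{ij}$ if only $(i,j)$ is open, and $\sigma^{(3)}_{ij}$ if both are open. $\mathcal{O}$-Oriented Descending Procedure: maintain a set $S$ (initially $\mathcal{O}$) and a matching $M$ (initially empty). Repeatedly: if $S$ is empty or the largest current index among baskets in $S$ is negative, stop and output $M$; otherwise advance the basket $(i,j)\in S$ with the largest current index (open its next box, or, if both boxes are open, add $\{i,j\}$ to $M$ and delete from $S$ all oriented edges incident to $i$ or $j$). Randomized Pandora Matching Algorithm: orient each edge $\{i,j\}$ as $(i,j)$ or $(j,i)$ uniformly at random, independently across edges, obtaining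 an orientation $\mathcal{O}$, and then run the $\mathcal{O}$-Oriented Descending Procedure. *)

theory Defs
  imports "HOL-Probability.Probability"
begin

text \<open>The box \<open>(i,j)\<close> is the ordered pair itself.\<close>

type_synonym 'v pbox = "'v \<times> 'v"

record 'v pandora =
  verts :: "'v set"
  edges :: "'v set set"
  law :: "'v pbox \<Rightarrow> real measure"
  cost :: "'v pbox \<Rightarrow> real"

definition boxes :: "'v pandora \<Rightarrow> 'v pbox set" where
  "boxes I = {(i, j). {i, j} \<in> edges I}"

definition pandora_instance :: "'v pandora \<Rightarrow> bool" where
  "pandora_instance I \<longleftrightarrow>
     finite (verts I) \<and> (\<forall>e\<in>edges I. e \<subseteq> verts I \<and> card e = 2) \<and>
     (\<forall>b\<in>boxes I. prob_space (law I b) \<and> sets (law I b) = sets borel \<and>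
        integrable (law I b) (\<lambda>x. x) \<and> cost I b \<ge> 0)"

definition matching :: "'v pandora \<Rightarrow> 'v set set \<Rightarrow> bool" where
  "matching I M \<longleftrightarrow> M \<subseteq> edges I \<and> pairwise disjnt M"

definition value_space :: "'v pandora \<Rightarrow> ('v pbox \<Rightarrow> real) measure" where
  "value_space I = Pi\<^sub>M (boxes I) (law I)"

text \<open>
  An outcome consists of the set of opened boxes and the output matching. It is a function of the
  internal randomness, drawn from \<open>R\<close>, and of the box values, drawn independently of it.
  The expectation is written as an iterated integral, rather than over the product measure, so that
  for \<open>R = measure_pmf p\<close> measurability in the values only matters on the support of \<open>p\<close>.
\<close>

type_synonym 'v outcome = "'v pbox set \<times> 'v set set"

definition net_value :: "'v pandora \<Rightarrow> ('v pbox \<Rightarrow> real) \<Rightarrow> 'v outcome \<Rightarrow> real" where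
  "net_value I v = (\<lambda>(B, M). \<Sum>(i, j)\<in>boxes I.
     of_bool ({i, j} \<in> M) * v (i, j) - of_bool ((i, j) \<in> B) * cost I (i, j))"

definition welfare ::
    "'v pandora \<Rightarrow> 'r measure \<Rightarrow> ('r \<Rightarrow> ('v pbox \<Rightarrow> real) \<Rightarrow> 'v outcome) \<Rightarrow> real" where
  "welfare I R out = (\<integral>r. (\<integral>v. net_value I v (out r v) \<partial>value_space I) \<partial>R)"


section \<open>Algorithms\<close>

datatype 'v action = Open "'v pbox" | Stop "'v set set"

text \<open>The opened boxes, in order, with the observed values.\<close>

type_synonym 'v history = "('v pbox \<times> real) list"

fun valid_action :: "'v pandora \<Rightarrow> 'v pbox set \<Rightarrow> 'v action \<Rightarrow> bool" where
  "valid_action I B (Open b) \<longleftrightarrow> b \<in> boxes I - B"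
| "valid_action I B (Stop M) \<longleftrightarrow> matching I M \<and> (\<forall>i j. {i, j} \<in> M \<longrightarrow> (i, j) \<in> B)"

text \<open>
  The last conjunct says that, for every sequence \<open>bs\<close> of opened boxes, the next action is a
  measurable function of the internal randomness and of the values observed in \<open>bs\<close>.
\<close>

definition algorithm ::
    "'v pandora \<Rightarrow> 'r measure \<Rightarrow> ('r \<Rightarrow> 'v history \<Rightarrow> 'v action) \<Rightarrow> bool" where
  "algorithm I R \<pi> \<longleftrightarrow> prob_space R \<and>
     (\<forall>r\<in>space R. \<forall>h. distinct (map fst h) \<and> fst ` set h \<subseteq> boxes I \<longrightarrow>
        valid_action I (fst ` set h) (\<pi> r h)) \<and>
     (\<forall>bs. distinct bs \<and> set bs \<subseteq> boxes I \<longrightarrow>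
        (\<lambda>(r, v). \<pi> r (map (\<lambda>b. (b, v b)) bs)) \<in> R \<Otimes>\<^sub>M value_space I \<rightarrow>\<^sub>M count_space UNIV)"

text \<open>
  The natural number bounds the number of actions. Every valid policy stops within
  \<open>card (boxes I) + 1\<close> actions, so that the bound in \<open>execute\<close> is never exhausted.
\<close>

fun run :: "('v history \<Rightarrow> 'v action) \<Rightarrow> ('v pbox \<Rightarrow> real) \<Rightarrow> nat \<Rightarrow> 'v history \<Rightarrow> 'v outcome" where
  "run p v 0 h = (fst ` set h, {})"
| "run p v (Suc n) h =
     (case p h of Open b \<Rightarrow> run p v n (h @ [(b, v b)]) | Stop M \<Rightarrow> (fst ` set h, M))"

definition execute ::
    "'v pandora \<Rightarrow> ('v history \<Rightarrow> 'v action) \<Rightarrow> ('v pbox \<Rightarrow> real) \<Rightarrow> 'v outcome" where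
  "execute I p v = run p v (card (boxes I) + 1) []"

text \<open>
  The optimal welfare, over all algorithms whose internal randomness is any probability space
  on the type \<open>'r\<close>.
\<close>

definition opt_welfare :: "'r itself \<Rightarrow> 'v pandora \<Rightarrow> ereal" where
  "opt_welfare _ I =
     (SUP (R, \<pi>) \<in> {(R :: 'r measure, \<pi>). algorithm I R \<pi>}.
        ereal (welfare I R (\<lambda>r. execute I (\<pi> r))))"


section \<open>Nested indices\<close>

text \<open>
  \<open>s\<close> solves \<open>E[(X - s)\<^sup>+] = c\<close>. For \<open>c > 0\<close> and integrable \<open>X\<close> there is exactly one solution and it
  is real. For \<open>c = 0\<close> the solutions are the essential upper bounds of \<open>X\<close>, which is why \<open>\<infinity>\<close> is
  admitted: it is the only solution if \<open>X\<close> is essentially unbounded. \<open>-\<infinity>\<close> is never a solution.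
\<close>

definition solves_index :: "'a measure \<Rightarrow> ('a \<Rightarrow> ereal) \<Rightarrow> real \<Rightarrow> ereal \<Rightarrow> bool" where
  "solves_index M X c s \<longleftrightarrow> (\<integral>\<^sup>+ x. e2ennreal (max (X x - s) 0) \<partial>M) = ennreal c"

definition kappa3 :: "real \<Rightarrow> real \<Rightarrow> ereal" where
  "kappa3 x y = ereal (x + y)"

definition kappa2 :: "(real \<Rightarrow> ereal) \<Rightarrow> real \<Rightarrow> real \<Rightarrow> ereal" where
  "kappa2 s2 x y = min (s2 x) (kappa3 x y)"

text \<open>
  \<open>\<sigma>1 (i, j)\<close> and \<open>\<sigma>2 (i, j)\<close> are the first and second index of the edge oriented as \<open>(i, j)\<close>, the
  latter as a function of the value \<open>x\<close> of box \<open>(i, j)\<close>. As the values are independent,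
  conditioning on that value amounts to integrating over the value \<open>y\<close> of box \<open>(j, i)\<close> only.
\<close>

definition nested_indices ::
    "'v pandora \<Rightarrow> ('v pbox \<Rightarrow> ereal) \<Rightarrow> ('v pbox \<Rightarrow> real \<Rightarrow> ereal) \<Rightarrow> bool" where
  "nested_indices I \<sigma>1 \<sigma>2 \<longleftrightarrow> (\<forall>(i, j)\<in>boxes I.
     \<sigma>2 (i, j) \<in> borel_measurable borel \<and>
     (AE x in law I (i, j). solves_index (law I (j, i)) (kappa3 x) (cost I (j, i)) (\<sigma>2 (i, j) x)) \<and>
     solves_index (law I (i, j) \<Otimes>\<^sub>M law I (j, i)) (\<lambda>(x, y). kappa2 (\<sigma>2 (i, j)) x y)
       (cost I (i, j)) (\<sigma>1 (i, j)))"

lemma solves_index_exists: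
  fixes X :: "'a \<Rightarrow> real"
  assumes "prob_space M" and X[measurable]: "integrable M X" and c: "c \<ge> 0"
  shows "\<exists>s. s \<noteq> -\<infinity> \<and> solves_index M (\<lambda>x. ereal (X x)) c s"
proof (cases "c = 0")
  case True
  then have "solves_index M (\<lambda>x. ereal (X x)) c \<infinity>"
    by (simp add: solves_index_def zero_ereal_def[symmetric] e2ennreal_neg max_def)
  then show ?thesis by (intro exI[of _ \<infinity>]) auto
next
  case False
  interpret prob_space M by fact
  define f where "f s = (\<integral>x. max (X x - s) 0 \<partial>M)" for s :: real
  have int: "integrable M (\<lambda>x. max (X x - s) 0)" for s
    using X by (intro Bochner_Integration.integrable_max) auto
  have lip: "\<bar>f s - f t\<bar> \<le> \<bar>s - t\<bar>" for s t
  proof -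
    have "\<bar>f s - f t\<bar> = \<bar>\<integral>x. (max (X x - s) 0 - max (X x - t) 0) \<partial>M\<bar>"
      unfolding f_def using int by simp
    also have "\<dots> \<le> (\<integral>x. \<bar>max (X x - s) 0 - max (X x - t) 0\<bar> \<partial>M)"
      by (rule integral_abs_bound)
    also have "\<dots> \<le> (\<integral>x. \<bar>s - t\<bar> \<partial>M)"
      using int by (intro integral_mono) (auto simp: max_def)
    finally show ?thesis by (simp add: prob_space)
  qed
  have cont: "continuous_on UNIV f"
    unfolding continuous_on_iff dist_real_def using lip by (meson le_less_trans)
  have lim: "(\<lambda>n. f (real n)) \<longlonglongrightarrow> (\<integral>x. 0 \<partial>M)"
    unfolding f_def
  proof (rule integral_dominated_convergence[where w = "\<lambda>x. \<bar>X x\<bar>"])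
    show "AE x in M. (\<lambda>n. max (X x - real n) 0) \<longlonglongrightarrow> 0"
    proof (rule AE_I2)
      fix x
      obtain N :: nat where "X x \<le> real N" using real_arch_simple by blast
      then have "\<forall>\<^sub>F n in sequentially. max (X x - real n) 0 = 0"
        by (intro eventually_sequentiallyI[of N]) auto
      then show "(\<lambda>n. max (X x - real n) 0) \<longlonglongrightarrow> 0"
        by (rule tendsto_eventually)
    qed
  qed (use X in auto)
  have "c > 0" using c False by simp
  then have "\<forall>\<^sub>F n in sequentially. f (real n) < c"
    using lim by (auto dest: order_tendstoD(2))
  then obtain n where n: "f (real n) < c"
    by (auto simp: eventually_sequentially)
  define a where "a = min (real n) ((\<integral>x. X x \<partial>M) - c)"
  have "c \<le> (\<integral>x. X x - a \<partial>M)"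
    using X by (simp add: a_def prob_space min_def)
  also have "\<dots> \<le> f a"
    unfolding f_def using X int by (intro integral_mono) auto
  finally have "\<exists>s. a \<le> s \<and> s \<le> real n \<and> f s = c"
    using n cont by (intro IVT2') (auto simp: a_def intro: continuous_on_subset)
  then obtain s where s: "f s = c" by blast
  have "(\<integral>\<^sup>+ x. ennreal (max (X x - s) 0) \<partial>M) = ennreal (f s)"
    unfolding f_def by (intro nn_integral_eq_integral int) auto
  then have "solves_index M (\<lambda>x. ereal (X x)) c (ereal s)"
    using s by (simp add: solves_index_def zero_ereal_def flip: e2ennreal_ereal)
  then show ?thesis by (intro exI[of _ "ereal s"]) auto
qed

text \<open>Nested indices exist for every instance.\<close>

lemma nested_indices_exist:
  assumes "pandora_instance I"
  shows "\<exists>\<sigma>1 \<sigma>2. nested_indices I \<sigma>1 \<sigma>2"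
proof -
  define P where "P i j s1 s2 \<longleftrightarrow> s2 \<in> borel_measurable borel \<and>
     (AE x in law I (i, j). solves_index (law I (j, i)) (kappa3 x) (cost I (j, i)) (s2 x)) \<and>
     solves_index (law I (i, j) \<Otimes>\<^sub>M law I (j, i)) (\<lambda>(x, y). kappa2 s2 x y) (cost I (i, j)) s1"
    for i j s1 s2
  have "\<exists>s1 s2. P i j s1 s2" if b: "(i, j) \<in> boxes I" for i j
  proof -
    let ?A = "law I (i, j)" and ?B = "law I (j, i)"
    have b': "(j, i) \<in> boxes I" using b by (auto simp: boxes_def insert_commute)
    have A: "prob_space ?A" "sets ?A = sets borel" "integrable ?A (\<lambda>x. x)" "cost I (i, j) \<ge> 0"
      and B: "prob_space ?B" "sets ?B = sets borel" "integrable ?B (\<lambda>x. x)" "cost I (j, i) \<ge> 0"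
      using assms b b' by (auto simp: pandora_instance_def)
    interpret A: prob_space ?A by fact
    interpret B: prob_space ?B by fact
    interpret AB: pair_prob_space ?A ?B ..
    obtain r where r: "r \<noteq> -\<infinity>" "solves_index ?B ereal (cost I (j, i)) r"
      using solves_index_exists[OF B(1,3,4)] by auto
    define s2 where "s2 x = ereal x + r" for x
    have s2: "solves_index ?B (kappa3 x) (cost I (j, i)) (s2 x)" for x
    proof -
      have "kappa3 x y - s2 x = ereal y - r" for y
        using r(1) by (cases r) (auto simp: kappa3_def s2_def)
      then show ?thesis using r(2) by (simp add: solves_index_def)
    qed
    define g where "g y = (if r = \<infinity> then y else min (real_of_ereal r) y)" for y
    have g: "integrable ?B g"
      unfolding g_def using B(3) by (cases "r = \<infinity>") (auto intro: Bochner_Integration.integrable_min)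
    have int: "integrable (?A \<Otimes>\<^sub>M ?B) (\<lambda>z. fst z + g (snd z))"
    proof (rule Bochner_Integration.integrable_add)
      show "integrable (?A \<Otimes>\<^sub>M ?B) fst"
        using integrable_distr[of fst "?A \<Otimes>\<^sub>M ?B" ?A "\<lambda>x. x"] A(3) B.distr_pair_fst[of ?A] by simp
    next
      show "integrable (?A \<Otimes>\<^sub>M ?B) (\<lambda>z. g (snd z))"
        using integrable_distr[of fst "?B \<Otimes>\<^sub>M ?A" ?B g] g A.distr_pair_fst[of ?B]
          AB.integrable_product_swap_iff[of "\<lambda>z. g (snd z)"] by (simp add: case_prod_unfold)
    qed
    obtain s1 where s1: "solves_index (?A \<Otimes>\<^sub>M ?B) (\<lambda>z. ereal (fst z + g (snd z))) (cost I (i, j)) s1"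
      using solves_index_exists[OF AB.prob_space_axioms int A(4)] by auto
    have "(\<lambda>z. ereal (fst z + g (snd z))) = (\<lambda>(x, y). kappa2 s2 x y)"
      using r(1) by (cases r) (auto simp: fun_eq_iff g_def kappa2_def kappa3_def s2_def min_def)
    moreover have "s2 \<in> borel_measurable borel"
      unfolding s2_def[abs_def] by measurable
    ultimately have "P i j s1 s2"
      using s1 s2 by (simp add: P_def)
    then show ?thesis by blast
  qed
  then obtain s1 s2 where "\<And>i j. (i, j) \<in> boxes I \<Longrightarrow> P i j (s1 i j) (s2 i j)"
    by metis
  then have "nested_indices I (\<lambda>(i, j). s1 i j) (\<lambda>(i, j). s2 i j)"
    unfolding nested_indices_def P_def by (auto simp only: prod.case)
  then show ?thesis by blast
qed


section \<open>The oriented descending procedure\<close>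

text \<open>The opened boxes, the set \<open>S\<close> of remaining oriented edges, and the current matching.\<close>

type_synonym 'v state = "'v pbox set \<times> 'v pbox set \<times> 'v set set"

definition current_index ::
    "('v pbox \<Rightarrow> ereal) \<Rightarrow> ('v pbox \<Rightarrow> real \<Rightarrow> ereal) \<Rightarrow> ('v pbox \<Rightarrow> real) \<Rightarrow> 'v pbox set \<Rightarrow>
     'v pbox \<Rightarrow> ereal" where
  "current_index \<sigma>1 \<sigma>2 v B = (\<lambda>(i, j).
     if (i, j) \<notin> B then \<sigma>1 (i, j)
     else if (j, i) \<notin> B then \<sigma>2 (i, j) (v (i, j))
     else kappa3 (v (i, j)) (v (j, i)))"

fun advance :: "'v pbox \<Rightarrow> 'v state \<Rightarrow> 'v state" where
  "advance (i, j) (B, S, M) =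
     (if (i, j) \<notin> B then (insert (i, j) B, S, M)
      else if (j, i) \<notin> B then (insert (j, i) B, S, M)
      else (B, {(k, l) \<in> S. {k, l} \<inter> {i, j} = {}}, insert {i, j} M))"

text \<open>
  \<open>tie s A\<close> is the basket advanced in state \<open>s\<close> if \<open>A\<close> is the set of baskets of largest index.
\<close>

definition tie_breaking :: "('v state \<Rightarrow> 'v pbox set \<Rightarrow> 'v pbox) \<Rightarrow> bool" where
  "tie_breaking tie \<longleftrightarrow> (\<forall>s A. A \<noteq> {} \<longrightarrow> tie s A \<in> A)"

fun descending_step ::
    "('v state \<Rightarrow> 'v pbox set \<Rightarrow> 'v pbox) \<Rightarrow> ('v pbox \<Rightarrow> ereal) \<Rightarrow> ('v pbox \<Rightarrow> real \<Rightarrow> ereal) \<Rightarrow>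
     ('v pbox \<Rightarrow> real) \<Rightarrow> 'v state \<Rightarrow> 'v state" where
  "descending_step tie \<sigma>1 \<sigma>2 v (B, S, M) =
     (let ind = current_index \<sigma>1 \<sigma>2 v B in
      if S = {} \<or> (\<forall>a\<in>S. ind a < 0) then (B, S, M)
      else advance (tie (B, S, M) {a \<in> S. \<forall>a'\<in>S. ind a' \<le> ind a}) (B, S, M))"

text \<open>
  Each of the \<open>card (edges I)\<close> baskets is advanced at most three times, so that the procedure has
  stopped after the given number of steps; a stopped state is left unchanged by further steps.
\<close>

definition descending_procedure ::
    "'v pandora \<Rightarrow> ('v state \<Rightarrow> 'v pbox set \<Rightarrow> 'v pbox) \<Rightarrow> ('v pbox \<Rightarrow> ereal) \<Rightarrow>
     ('v pbox \<Rightarrow> real \<Rightarrow> ereal) \<Rightarrow> 'v pbox set \<Rightarrow> ('v pbox \<Rightarrow> real) \<Rightarrow> 'v outcome" where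
  "descending_procedure I tie \<sigma>1 \<sigma>2 ori v =
     (case (descending_step tie \<sigma>1 \<sigma>2 v ^^ (3 * card (edges I))) ({}, ori, {}) of
        (B, S, M) \<Rightarrow> (B, M))"

definition random_orientation :: "'v pandora \<Rightarrow> 'v pbox set pmf" where
  "random_orientation I =
     map_pmf (\<lambda>f. f ` edges I) (Pi_pmf (edges I) undefined (\<lambda>e. pmf_of_set {(i, j). {i, j} = e}))"

definition randomized_welfare ::
    "'v pandora \<Rightarrow> ('v state \<Rightarrow> 'v pbox set \<Rightarrow> 'v pbox) \<Rightarrow> ('v pbox \<Rightarrow> ereal) \<Rightarrow>
     ('v pbox \<Rightarrow> real \<Rightarrow> ereal) \<Rightarrow> real" where
  "randomized_welfare I tie \<sigma>1 \<sigma>2 =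
     welfare I (measure_pmf (random_orientation I)) (descending_procedure I tie \<sigma>1 \<sigma>2)"

end

theory Submission
  imports Defs
begin

text \<open>
  Let \<open>a\<close> be a box that some algorithm opens before its reverse. Whether \<open>a\<close> is opened first does not
  depend on the two values of the edge, and whether the reverse is then opened does not depend on
  its value. Hence in expectation each cost equals the excess \<open>E[(\<kappa> - \<sigma>)\<^sup>+]\<close> that defines the
  corresponding index, and the contribution of the edge is at most that of \<open>\<kappa>\<^sup>(\<^sup>1\<^sup>)\<close> on the event that
  the edge is matched. Equality holds if an edge whose value exceeds its last index is always matched.
  The descending procedure has this property, because such a basket stays the unique maximal one.
  Moreover it selects edges greedily with respect to \<open>\<kappa>\<^sup>(\<^sup>1\<^sup>)\<close>, which costs at most a factor 2 against
  any matching, in particular the one of the optimal algorithm. A random orientation agrees with the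
  order in which the optimum opens the two boxes of an edge with probability 1/2, which costs
  another factor 2.
\<close>

section \<open>Indices and amortization of costs\<close>

text \<open>The order in which the optimum opens the two boxes of an edge depends on observed
  values, so no fixed orientation reproduces it. The bound therefore counts each edge matched by the
  optimum in both orientations, with the positive part of \<open>k1\<close>, so that the orientation
  that did not occur contributes nothing negative. In this sum the orientation enters only through
  indicators of ordered pairs, and averaging gives each of them the factor 1/2. The greedy
  comparison can thus be made separately for every orientation and almost every value vector.
  Independence enters only by resampling: replacing one coordinate by a fresh copy keeps the
  integral, and an event that ignores this coordinate factors out of the inner integral. Indices may
  be infinite, so they are never subtracted from values. Real charges, truncated to 0 where a
  difference is infinite, are subtracted from the real \<open>k3\<close> instead.\<close>

definition excess :: "ereal \<Rightarrow> ereal \<Rightarrow> real" where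
  "excess x s = enn2real (e2ennreal (max (x - s) 0))"

lemma excess_nonneg [simp]: "0 \<le> excess x s"
  by (simp add: excess_def)

lemma excess_posD: "excess x s > 0 \<Longrightarrow> s < x"
  by (cases x; cases s)
     (auto simp: excess_def max_def zero_ereal_def e2ennreal_ereal ennreal_neg split: if_splits)

text \<open>The difference is \<open>\<infinity>\<close> exactly if one of the two assumptions
  fails, and there \<open>excess\<close> falls back to 0. Elsewhere it loses nothing against the
  integrand of \<open>solves_index\<close>.\<close>

lemma e2ennreal_excess:
  assumes "s \<noteq> -\<infinity>" "x \<noteq> \<infinity>"
  shows "e2ennreal (max (x - s) 0) = ennreal (excess x s)"
  using assms
  by (cases x; cases s) (auto simp: excess_def max_def zero_ereal_def e2ennreal_ereal e2ennreal_neg)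

text \<open>Passing from one \<open>\<kappa>\<close> to the preceding one thus subtracts exactly a
  charge. Applied twice, this turns \<open>K1\<close> into the real expression
  \<open>k1\<close>.\<close>

lemma min_eq_diff_excess:
  assumes "s \<noteq> -\<infinity>"
  shows "min s (ereal x) = ereal (x - excess (ereal x) s)"
  using assms
  by (cases s) (auto simp: excess_def max_def zero_ereal_def e2ennreal_ereal e2ennreal_neg)

lemma excess_measurable [measurable]:
  assumes [measurable]: "f \<in> borel_measurable M" "g \<in> borel_measurable M"
  shows "(\<lambda>x. excess (f x) (g x)) \<in> borel_measurable M"
  unfolding excess_def by measurable

lemma solves_index_not_MInfty:
  assumes "prob_space M" "solves_index M X c s" shows "s \<noteq> -\<infinity>"
proof
  interpret prob_space M by fact
  assume "s = -\<infinity>"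
  then have "(\<integral>\<^sup>+ x. e2ennreal (max (X x - s) 0) \<partial>M) = \<infinity>"
    by (simp add: emeasure_space_1)
  then show False using assms(2) by (simp add: solves_index_def)
qed

text \<open>The inner integral no longer depends on coordinate \<open>i\<close>, so integrating it
  once more over a probability measure changes nothing. This replaces conditional expectations:
  everything known to be independent of one box value is pulled out of the inner integral.\<close>

lemma (in product_sigma_finite) nn_integral_resample:
  assumes "finite J" "i \<in> J" "prob_space (M i)"
    and H [measurable]: "H \<in> borel_measurable (Pi\<^sub>M J M)"
  shows "(\<integral>\<^sup>+ v. H v \<partial>Pi\<^sub>M J M) = (\<integral>\<^sup>+ v. (\<integral>\<^sup>+ y. H (v(i := y)) \<partial>M i) \<partial>Pi\<^sub>M J M)"
proof -
  define J' where "J' = J - {i}"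
  have J: "J = insert i J'" "i \<notin> J'" "finite J'" using assms by (auto simp: J'_def)
  interpret i: prob_space "M i" by fact
  have H' [measurable]: "H \<in> borel_measurable (Pi\<^sub>M (insert i J') M)" using H J by simp
  have m: "(\<lambda>v. \<integral>\<^sup>+ y. H (v(i := y)) \<partial>M i) \<in> borel_measurable (Pi\<^sub>M (insert i J') M)"
  proof -
    have [measurable]: "(\<lambda>(f, y). f(i := y)) \<in> Pi\<^sub>M (insert i J') M \<Otimes>\<^sub>M M i \<rightarrow>\<^sub>M Pi\<^sub>M (insert i J') M"
      using measurable_add_dim[of i "insert i J'" M] by simp
    have "(\<lambda>(v, y). H (v(i := y))) \<in> borel_measurable (Pi\<^sub>M (insert i J') M \<Otimes>\<^sub>M M i)"
      using measurable_compose[OF \<open>(\<lambda>(f, y). f(i := y)) \<in> _\<close> H'] by (simp add: case_prod_unfold)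
    then show ?thesis by (rule borel_measurable_nn_integral)
  qed
  have "(\<integral>\<^sup>+ v. (\<integral>\<^sup>+ y. H (v(i := y)) \<partial>M i) \<partial>Pi\<^sub>M (insert i J') M) =
      (\<integral>\<^sup>+ x. (\<integral>\<^sup>+ z. (\<integral>\<^sup>+ y. H (x(i := y)) \<partial>M i) \<partial>M i) \<partial>Pi\<^sub>M J' M)"
    by (subst product_nn_integral_insert[OF J(3,2) m]) simp
  also have "\<dots> = (\<integral>\<^sup>+ x. (\<integral>\<^sup>+ y. H (x(i := y)) \<partial>M i) \<partial>Pi\<^sub>M J' M)"
    by (simp add: i.emeasure_space_1)
  also have "\<dots> = (\<integral>\<^sup>+ v. H v \<partial>Pi\<^sub>M (insert i J') M)"
    by (rule product_nn_integral_insert[OF J(3,2) H', symmetric])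
  finally show ?thesis using J by simp
qed

lemma integrable_of_bool_mult:
  fixes f :: "'a \<Rightarrow> real"
  assumes f: "integrable M f" and [measurable]: "Measurable.pred M P"
  shows "integrable M (\<lambda>x. of_bool (P x) * f x)"
proof (rule Bochner_Integration.integrable_bound[OF f])
  have [measurable]: "f \<in> borel_measurable M" using f by simp
  show "(\<lambda>x. of_bool (P x) * f x) \<in> borel_measurable M" by measurable
qed auto

lemma swap_in_boxes [simp]: "prod.swap a \<in> boxes I \<longleftrightarrow> a \<in> boxes I"
  by (cases a) (simp add: boxes_def insert_commute)

section \<open>Values, indices and charges of a fixed instance\<close>

locale pandora_indices =
  fixes I :: "'v pandora" and \<sigma>1 :: "'v pbox \<Rightarrow> ereal" and \<sigma>2 :: "'v pbox \<Rightarrow> real \<Rightarrow> ereal"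
  assumes inst: "pandora_instance I" and nested: "nested_indices I \<sigma>1 \<sigma>2"
begin

text \<open>
  \<open>k3\<close>, \<open>K2\<close>, \<open>K1\<close> are \<open>\<kappa>\<^sup>(\<^sup>3\<^sup>)\<close>, \<open>\<kappa>\<^sup>(\<^sup>2\<^sup>)\<close>, \<open>\<kappa>\<^sup>(\<^sup>1\<^sup>)\<close>. The real-valued \<open>k1\<close> agrees with \<open>K1\<close> except on the null set
  where \<open>\<sigma>2\<close> is \<open>-\<infinity>\<close>.
\<close>

definition k3 :: "'v pbox \<Rightarrow> ('v pbox \<Rightarrow> real) \<Rightarrow> real" where
  "k3 a v = v a + v (prod.swap a)"

definition K2 :: "'v pbox \<Rightarrow> ('v pbox \<Rightarrow> real) \<Rightarrow> ereal" where
  "K2 a v = min (\<sigma>2 a (v a)) (ereal (k3 a v))"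

definition K1 :: "'v pbox \<Rightarrow> ('v pbox \<Rightarrow> real) \<Rightarrow> ereal" where
  "K1 a v = min (\<sigma>1 a) (K2 a v)"

text \<open>\<open>d2\<close> and \<open>d1\<close> are the integrands of the equations that define
  the two indices. Their means are the costs of the second and the first box, and they are charged
  in place of these costs.\<close>

definition d2 :: "'v pbox \<Rightarrow> ('v pbox \<Rightarrow> real) \<Rightarrow> real" where
  "d2 a v = excess (ereal (k3 a v)) (\<sigma>2 a (v a))"

definition d1 :: "'v pbox \<Rightarrow> ('v pbox \<Rightarrow> real) \<Rightarrow> real" where
  "d1 a v = excess (K2 a v) (\<sigma>1 a)"

definition k1 :: "'v pbox \<Rightarrow> ('v pbox \<Rightarrow> real) \<Rightarrow> real" where
  "k1 a v = k3 a v - d2 a v - d1 a v"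

lemma finite_edges: "finite (edges I)"
proof -
  have "edges I \<subseteq> Pow (verts I)" "finite (verts I)" using inst by (auto simp: pandora_instance_def)
  then show ?thesis by (meson finite_Pow_iff finite_subset)
qed

lemma finite_boxes: "finite (boxes I)"
proof -
  have "boxes I \<subseteq> verts I \<times> verts I" "finite (verts I)"
    using inst by (auto simp: pandora_instance_def boxes_def)
  then show ?thesis by (meson finite_SigmaI finite_subset)
qed

lemma swap_neq: "a \<in> boxes I \<Longrightarrow> prod.swap a \<noteq> a"
  using inst by (cases a) (auto simp: pandora_instance_def boxes_def)

lemma law_prob: "b \<in> boxes I \<Longrightarrow> prob_space (law I b)"
  and law_sets: "b \<in> boxes I \<Longrightarrow> sets (law I b) = sets borel"
  and law_int: "b \<in> boxes I \<Longrightarrow> integrable (law I b) (\<lambda>x. x)"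
  and cost_nonneg: "b \<in> boxes I \<Longrightarrow> 0 \<le> cost I b"
  using inst by (auto simp: pandora_instance_def)

text \<open>Boxes outside the instance get a dummy law, since the library's product measures require
  a law at every index.\<close>

definition law' :: "'v pbox \<Rightarrow> real measure" where
  "law' b = (if b \<in> boxes I then law I b else return borel 0)"

lemma law'_eq [simp]: "b \<in> boxes I \<Longrightarrow> law' b = law I b"
  by (simp add: law'_def)

lemma value_space_law': "value_space I = Pi\<^sub>M (boxes I) law'"
  unfolding value_space_def by (intro PiM_cong) auto

lemma prob_law': "prob_space (law' b)"
  unfolding law'_def using law_prob by (auto intro: prob_space_return)

sublocale law': product_prob_space law' "boxes I"
  by (rule product_prob_spaceI) (rule prob_law')

sublocale vs: prob_space "value_space I"
  unfolding value_space_law' by (rule prob_space_PiM) (rule prob_law')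

lemma component_measurable [measurable]:
  assumes "b \<in> boxes I"
  shows "(\<lambda>v. v b) \<in> borel_measurable (value_space I)"
proof -
  have "(\<lambda>v. v b) \<in> value_space I \<rightarrow>\<^sub>M law I b"
    unfolding value_space_def using assms by (rule measurable_component_singleton)
  also have "(value_space I \<rightarrow>\<^sub>M law I b) = borel_measurable (value_space I)"
    using law_sets[OF assms] by (intro measurable_cong_sets) auto
  finally show ?thesis .
qed

lemma component_distr: "b \<in> boxes I \<Longrightarrow> distr (value_space I) (law I b) (\<lambda>v. v b) = law I b"
  unfolding value_space_def using law_prob by (rule distr_PiM_component)

lemma integrable_component:
  assumes "b \<in> boxes I"
  shows "integrable (value_space I) (\<lambda>v. v b)"
proof -
  have "(\<lambda>v. v b) \<in> value_space I \<rightarrow>\<^sub>M law I b"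
    unfolding value_space_def using assms by (rule measurable_component_singleton)
  then show ?thesis
    using integrable_distr[of "\<lambda>v. v b" "value_space I" "law I b" "\<lambda>x. x"]
      component_distr[OF assms] law_int[OF assms] by simp
qed

lemma AE_component:
  assumes "b \<in> boxes I" "AE x in law I b. P x"
  shows "AE v in value_space I. P (v b)"
  unfolding value_space_def using law_prob assms by (rule AE_PiM_component)

lemma \<sigma>2_measurable [measurable]: "a \<in> boxes I \<Longrightarrow> \<sigma>2 a \<in> borel_measurable borel"
  using nested by (cases a) (auto simp: nested_indices_def)

lemma \<sigma>2_solves:
  "a \<in> boxes I \<Longrightarrow> AE x in law I a.
     solves_index (law I (prod.swap a)) (kappa3 x) (cost I (prod.swap a)) (\<sigma>2 a x)"
  using nested by (cases a) (auto simp: nested_indices_def)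

lemma \<sigma>1_solves:
  "a \<in> boxes I \<Longrightarrow> solves_index (law I a \<Otimes>\<^sub>M law I (prod.swap a))
     (\<lambda>(x, y). kappa2 (\<sigma>2 a) x y) (cost I a) (\<sigma>1 a)"
  using nested by (cases a) (auto simp: nested_indices_def)

lemma \<sigma>1_not_MInfty: "a \<in> boxes I \<Longrightarrow> \<sigma>1 a \<noteq> -\<infinity>"
proof -
  assume a: "a \<in> boxes I"
  interpret A: prob_space "law I a" using a by (rule law_prob)
  interpret B: prob_space "law I (prod.swap a)" using a by (intro law_prob) simp
  interpret pair_prob_space "law I a" "law I (prod.swap a)" ..
  show ?thesis using \<sigma>1_solves[OF a] prob_space_axioms by (rule solves_index_not_MInfty[rotated])
qed

text \<open>\<open>nested_indices\<close> constrains \<open>\<sigma>2\<close> only for almost every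
  value. There are finitely many boxes, so one null set serves all of them.\<close>

lemma AE_\<sigma>2_not_MInfty: "AE v in value_space I. \<forall>a\<in>boxes I. \<sigma>2 a (v a) \<noteq> -\<infinity>"
proof (rule AE_finite_allI[OF finite_boxes])
  fix a assume a: "a \<in> boxes I"
  then have "prob_space (law I (prod.swap a))" by (intro law_prob) simp
  then have "AE x in law I a. \<sigma>2 a x \<noteq> -\<infinity>"
    using \<sigma>2_solves[OF a] by (auto elim!: eventually_mono dest: solves_index_not_MInfty)
  then show "AE v in value_space I. \<sigma>2 a (v a) \<noteq> -\<infinity>" using a by (rule AE_component[rotated])
qed

lemma k1_eq_K1:
  assumes "a \<in> boxes I" "\<sigma>2 a (v a) \<noteq> -\<infinity>"
  shows "ereal (k1 a v) = K1 a v"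
proof -
  have "K2 a v = ereal (k3 a v - d2 a v)"
    unfolding K2_def d2_def using assms by (intro min_eq_diff_excess)
  then show ?thesis
    using min_eq_diff_excess[OF \<sigma>1_not_MInfty[OF assms(1)], of "k3 a v - d2 a v"]
    by (simp add: K1_def k1_def d1_def)
qed

lemma k_measurable [measurable]:
  assumes "a \<in> boxes I"
  shows "k3 a \<in> borel_measurable (value_space I)" "K2 a \<in> borel_measurable (value_space I)"
    "d2 a \<in> borel_measurable (value_space I)" "d1 a \<in> borel_measurable (value_space I)"
proof -
  have a: "a \<in> boxes I" "prod.swap a \<in> boxes I" using assms by auto
  note [measurable] = component_measurable[OF a(1)] component_measurable[OF a(2)]
    \<sigma>2_measurable[OF a(1)]
  show m3 [measurable]: "k3 a \<in> borel_measurable (value_space I)"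
    unfolding k3_def[abs_def] by measurable
  show m2 [measurable]: "K2 a \<in> borel_measurable (value_space I)"
    unfolding K2_def[abs_def] by measurable
  show "d2 a \<in> borel_measurable (value_space I)" unfolding d2_def[abs_def] by measurable
  show "d1 a \<in> borel_measurable (value_space I)" unfolding d1_def[abs_def] by measurable
qed

lemma integrable_k3: "a \<in> boxes I \<Longrightarrow> integrable (value_space I) (k3 a)"
  unfolding k3_def[abs_def] by (intro Bochner_Integration.integrable_add integrable_component) auto

section \<open>Expected charges equal expected costs\<close>

lemma nn_integral_resample:
  assumes "b \<in> boxes I" "H \<in> borel_measurable (value_space I)"
  shows "(\<integral>\<^sup>+ v. H v \<partial>value_space I) = (\<integral>\<^sup>+ v. (\<integral>\<^sup>+ y. H (v(b := y)) \<partial>law I b) \<partial>value_space I)"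
  using law'.nn_integral_resample[OF finite_boxes assms(1) prob_law', of H] assms
  unfolding value_space_law' by simp

text \<open>Resampling the second value leaves \<open>G\<close> alone, and the inner integral of
  \<open>d2\<close> is then the equation of \<open>\<sigma>2\<close> at the first value, which holds
  for almost every such value.\<close>

lemma nn_integral_d2:
  assumes a: "a \<in> boxes I" and [measurable]: "Measurable.pred (value_space I) G"
    and G: "\<And>v y. G (v(prod.swap a := y)) = G v"
  shows "(\<integral>\<^sup>+ v. of_bool (G v) * ennreal (d2 a v) \<partial>value_space I) =
    (\<integral>\<^sup>+ v. of_bool (G v) * ennreal (cost I (prod.swap a)) \<partial>value_space I)"
proof -
  let ?b = "prod.swap a"
  have b: "?b \<in> boxes I" "a \<noteq> ?b" using a swap_neq[of a] by auto
  note [measurable] = k_measurable[OF a]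
  have "(\<integral>\<^sup>+ v. of_bool (G v) * ennreal (d2 a v) \<partial>value_space I) =
     (\<integral>\<^sup>+ v. (\<integral>\<^sup>+ y. of_bool (G v) * ennreal (d2 a (v(?b := y))) \<partial>law I ?b) \<partial>value_space I)"
    by (subst nn_integral_resample[OF b(1)]) (simp_all add: G)
  also have "\<dots> = (\<integral>\<^sup>+ v. of_bool (G v) * ennreal (cost I ?b) \<partial>value_space I)"
  proof (rule nn_integral_cong_AE)
    have "AE v in value_space I. solves_index (law I ?b) (kappa3 (v a)) (cost I ?b) (\<sigma>2 a (v a))"
      by (rule AE_component[OF a \<sigma>2_solves[OF a]])
    then show "AE v in value_space I. (\<integral>\<^sup>+ y. of_bool (G v) * ennreal (d2 a (v(?b := y))) \<partial>law I ?b) =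
        of_bool (G v) * ennreal (cost I ?b)"
    proof eventually_elim
      case (elim v)
      have "\<sigma>2 a (v a) \<noteq> -\<infinity>"
        using elim law_prob[OF b(1)] by (auto dest: solves_index_not_MInfty)
      then have "ennreal (d2 a (v(?b := y))) = e2ennreal (max (kappa3 (v a) y - \<sigma>2 a (v a)) 0)" for y
        using b(2) by (subst e2ennreal_excess) (auto simp: d2_def k3_def kappa3_def)
      then show ?case
        using elim by (cases "G v") (simp_all add: solves_index_def)
    qed
  qed
  finally show ?thesis .
qed

text \<open>Both values are resampled in turn. By Tonelli the two inner integrals form the integral
  over the product of the two laws in the equation of \<open>\<sigma>1\<close>.\<close>

lemma nn_integral_d1:
  assumes a: "a \<in> boxes I" and [measurable]: "Measurable.pred (value_space I) F"
    and F: "\<And>v y. F (v(a := y)) = F v" "\<And>v y. F (v(prod.swap a := y)) = F v"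
  shows "(\<integral>\<^sup>+ v. of_bool (F v) * ennreal (d1 a v) \<partial>value_space I) =
    (\<integral>\<^sup>+ v. of_bool (F v) * ennreal (cost I a) \<partial>value_space I)"
proof -
  let ?b = "prod.swap a"
  have b: "?b \<in> boxes I" "a \<noteq> ?b" using a swap_neq[of a] by auto
  note [measurable] = k_measurable[OF a] \<sigma>2_measurable[OF a]
  interpret A: prob_space "law I a" using a by (rule law_prob)
  interpret B: prob_space "law I ?b" using b(1) by (rule law_prob)
  \<comment> \<open>The charge as a function of the two values alone, kept in the form used by
    \<open>solves_index\<close>.\<close>
  define h where "h x y = e2ennreal (max (kappa2 (\<sigma>2 a) x y - \<sigma>1 a) 0)" for x y
  have h: "(\<lambda>(x, y). h x y) \<in> borel_measurable (law I a \<Otimes>\<^sub>M law I ?b)"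
  proof -
    have "(\<lambda>(x, y). h x y) \<in> borel_measurable (borel \<Otimes>\<^sub>M borel)"
      unfolding h_def kappa2_def kappa3_def by measurable
    moreover have "sets (law I a \<Otimes>\<^sub>M law I ?b) = sets (borel \<Otimes>\<^sub>M borel)"
      using law_sets[OF a] law_sets[OF b(1)] by (rule sets_pair_measure_cong)
    ultimately show ?thesis by (simp cong: measurable_cong_sets)
  qed
  have d: "ennreal (d1 a v) = h (v a) (v ?b)" for v
    unfolding h_def using \<sigma>1_not_MInfty[OF a]
    by (subst e2ennreal_excess) (auto simp: d1_def K2_def k3_def kappa2_def kappa3_def min_def)
  have hm: "(\<lambda>v. h (v a) (v ?b)) \<in> borel_measurable (value_space I)"
    unfolding d[symmetric] by measurable
  have "(\<integral>\<^sup>+ v. of_bool (F v) * ennreal (d1 a v) \<partial>value_space I) =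
     (\<integral>\<^sup>+ v. (\<integral>\<^sup>+ y. of_bool (F v) * h (v a) y \<partial>law I ?b) \<partial>value_space I)"
    using b(2) hm by (subst nn_integral_resample[OF b(1)]) (simp_all add: F d)
  also have "\<dots> = (\<integral>\<^sup>+ v. of_bool (F v) * (\<integral>\<^sup>+ y. h (v a) y \<partial>law I ?b) \<partial>value_space I)"
    by (intro nn_integral_cong) (simp add: of_bool_def)
  also have "\<dots> = (\<integral>\<^sup>+ v. (\<integral>\<^sup>+ x. of_bool (F v) * (\<integral>\<^sup>+ y. h x y \<partial>law I ?b) \<partial>law I a) \<partial>value_space I)"
  proof (subst nn_integral_resample[OF a])
    have "(\<lambda>x. \<integral>\<^sup>+ y. h x y \<partial>law I ?b) \<in> borel_measurable (law I a)"
      by (rule B.borel_measurable_nn_integral[OF h])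
    then have [measurable]: "(\<lambda>x. \<integral>\<^sup>+ y. h x y \<partial>law I ?b) \<in> borel_measurable borel"
      using law_sets[OF a] by (simp cong: measurable_cong_sets)
    note [measurable] = component_measurable[OF a]
    show "(\<lambda>v. of_bool (F v) * (\<integral>\<^sup>+ y. h (v a) y \<partial>law I ?b)) \<in> borel_measurable (value_space I)"
      by measurable
  qed (simp add: F)
  also have "\<dots> = (\<integral>\<^sup>+ v. of_bool (F v) * (\<integral>\<^sup>+ x. (\<integral>\<^sup>+ y. h x y \<partial>law I ?b) \<partial>law I a) \<partial>value_space I)"
    by (intro nn_integral_cong) (simp add: of_bool_def)
  also have "(\<integral>\<^sup>+ x. (\<integral>\<^sup>+ y. h x y \<partial>law I ?b) \<partial>law I a) = ennreal (cost I a)"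
    using B.nn_integral_fst[OF h] \<sigma>1_solves[OF a]
    by (simp add: solves_index_def h_def case_prod_unfold)
  finally show ?thesis .
qed

lemma d1_integral:
  assumes a: "a \<in> boxes I" and [measurable]: "Measurable.pred (value_space I) F"
    and F: "\<And>v y. F (v(a := y)) = F v" "\<And>v y. F (v(prod.swap a := y)) = F v"
  shows "has_bochner_integral (value_space I) (\<lambda>v. of_bool (F v) * d1 a v)
    (\<integral>v. of_bool (F v) * cost I a \<partial>value_space I)"
proof (rule has_bochner_integral_nn_integral)
  note [measurable] = k_measurable[OF a]
  show "(\<lambda>v. of_bool (F v) * d1 a v) \<in> borel_measurable (value_space I)" by measurable
  show "AE v in value_space I. 0 \<le> of_bool (F v) * d1 a v" by (simp add: d1_def)
  show "0 \<le> (\<integral>v. of_bool (F v) * cost I a \<partial>value_space I)"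
    using cost_nonneg[OF a] by simp
  have "(\<integral>\<^sup>+ v. ennreal (of_bool (F v) * d1 a v) \<partial>value_space I) =
      (\<integral>\<^sup>+ v. of_bool (F v) * ennreal (d1 a v) \<partial>value_space I)"
    by (intro nn_integral_cong) (simp add: of_bool_def)
  also have "\<dots> = (\<integral>\<^sup>+ v. of_bool (F v) * ennreal (cost I a) \<partial>value_space I)"
    using assms by (intro nn_integral_d1) auto
  also have "\<dots> = (\<integral>\<^sup>+ v. ennreal (of_bool (F v) * cost I a) \<partial>value_space I)"
    by (intro nn_integral_cong) (simp add: of_bool_def)
  also have "\<dots> = ennreal (\<integral>v. of_bool (F v) * cost I a \<partial>value_space I)"
    using cost_nonneg[OF a] by (intro nn_integral_eq_integral integrable_of_bool_mult) auto
  finally show "(\<integral>\<^sup>+ v. ennreal (of_bool (F v) * d1 a v) \<partial>value_space I) =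
    ennreal (\<integral>v. of_bool (F v) * cost I a \<partial>value_space I)" .
qed

lemma d2_integral:
  assumes a: "a \<in> boxes I" and [measurable]: "Measurable.pred (value_space I) G"
    and G: "\<And>v y. G (v(prod.swap a := y)) = G v"
  shows "has_bochner_integral (value_space I) (\<lambda>v. of_bool (G v) * d2 a v)
    (\<integral>v. of_bool (G v) * cost I (prod.swap a) \<partial>value_space I)"
proof (rule has_bochner_integral_nn_integral)
  note [measurable] = k_measurable[OF a]
  show "(\<lambda>v. of_bool (G v) * d2 a v) \<in> borel_measurable (value_space I)" by measurable
  show "AE v in value_space I. 0 \<le> of_bool (G v) * d2 a v" by (simp add: d2_def)
  have c: "0 \<le> cost I (prod.swap a)" using a by (intro cost_nonneg) simp
  then show "0 \<le> (\<integral>v. of_bool (G v) * cost I (prod.swap a) \<partial>value_space I)" by simp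
  have "(\<integral>\<^sup>+ v. ennreal (of_bool (G v) * d2 a v) \<partial>value_space I) =
      (\<integral>\<^sup>+ v. of_bool (G v) * ennreal (d2 a v) \<partial>value_space I)"
    by (intro nn_integral_cong) (simp add: of_bool_def)
  also have "\<dots> = (\<integral>\<^sup>+ v. of_bool (G v) * ennreal (cost I (prod.swap a)) \<partial>value_space I)"
    using assms by (intro nn_integral_d2) auto
  also have "\<dots> = (\<integral>\<^sup>+ v. ennreal (of_bool (G v) * cost I (prod.swap a)) \<partial>value_space I)"
    by (intro nn_integral_cong) (simp add: of_bool_def)
  also have "\<dots> = ennreal (\<integral>v. of_bool (G v) * cost I (prod.swap a) \<partial>value_space I)"
    using c by (intro nn_integral_eq_integral integrable_of_bool_mult) auto
  finally show "(\<integral>\<^sup>+ v. ennreal (of_bool (G v) * d2 a v) \<partial>value_space I) =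
    ennreal (\<integral>v. of_bool (G v) * cost I (prod.swap a) \<partial>value_space I)" .
qed

text \<open>Integrability of the charge comes from the index equation itself: for the trivial event
  its integral is the finite cost.\<close>

lemma integrable_d1: "a \<in> boxes I \<Longrightarrow> integrable (value_space I) (d1 a)"
  using d1_integral[of a "\<lambda>_. True"] by (simp add: has_bochner_integral_iff)

lemma integrable_d2: "a \<in> boxes I \<Longrightarrow> integrable (value_space I) (d2 a)"
  using d2_integral[of a "\<lambda>_. True"] by (simp add: has_bochner_integral_iff)

lemma integrable_k1: "a \<in> boxes I \<Longrightarrow> integrable (value_space I) (k1 a)"
  unfolding k1_def[abs_def]
  by (intro Bochner_Integration.integrable_diff integrable_k3 integrable_d1 integrable_d2)

end

text \<open>
  \<open>B n v\<close> is the set of boxes opened within the first \<open>n\<close> steps and \<open>M v\<close> the final matching. This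
  covers both arbitrary policies and the descending procedure.
\<close>

locale exploration = pandora_indices I \<sigma>1 \<sigma>2
  for I :: "'v pandora" and \<sigma>1 :: "'v pbox \<Rightarrow> ereal" and \<sigma>2 :: "'v pbox \<Rightarrow> real \<Rightarrow> ereal" +
  fixes B :: "nat \<Rightarrow> ('v pbox \<Rightarrow> real) \<Rightarrow> 'v pbox set" and N :: nat
    and M :: "('v pbox \<Rightarrow> real) \<Rightarrow> 'v set set"
  assumes B_0: "B 0 v = {}"
    and B_Suc: "B n v \<subseteq> B (Suc n) v"
    and B_single: "\<exists>b. B (Suc n) v \<subseteq> insert b (B n v)"
    and B_predictable: "(\<And>b. b \<in> B n v \<Longrightarrow> v' b = v b) \<Longrightarrow> B (Suc n) v' = B (Suc n) v"
    and B_measurable: "Measurable.pred (value_space I) (\<lambda>v. b \<in> B n v)"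
    and M_measurable: "Measurable.pred (value_space I) (\<lambda>v. e \<in> M v)"
    and M_open: "{i, j} \<in> M v \<Longrightarrow> (i, j) \<in> B N v"
begin

section \<open>The order in which the boxes of an edge are opened\<close>

definition first :: "'v pbox \<Rightarrow> ('v pbox \<Rightarrow> real) \<Rightarrow> bool" where
  "first a v \<longleftrightarrow> (\<exists>n<N. a \<notin> B n v \<and> prod.swap a \<notin> B n v \<and> a \<in> B (Suc n) v)"

definition both :: "'v pbox \<Rightarrow> ('v pbox \<Rightarrow> real) \<Rightarrow> bool" where
  "both a v \<longleftrightarrow> first a v \<and> prod.swap a \<in> B N v"

definition matched :: "'v pbox \<Rightarrow> ('v pbox \<Rightarrow> real) \<Rightarrow> bool" where
  "matched a v \<longleftrightarrow> first a v \<and> {fst a, snd a} \<in> M v"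

lemma B_mono: "m \<le> n \<Longrightarrow> B m v \<subseteq> B n v"
  by (rule lift_Suc_mono_le[of "\<lambda>n. B n v"]) (rule B_Suc)

lemma B_cong:
  assumes "\<And>b. b \<in> B n v \<Longrightarrow> v' b = v b" "m \<le> Suc n"
  shows "B m v' = B m v"
proof (cases m)
  case (Suc k)
  then have "B k v \<subseteq> B n v" using assms(2) by (intro B_mono) simp
  then show ?thesis using assms(1) Suc B_predictable[of k v v'] by blast
qed (simp add: B_0)

text \<open>Until the step that opens \<open>a\<close>, only values of other edges have been
  observed. By predictability the run is the same up to and including this step.\<close>

lemma first_cong_imp:
  assumes "first a v" "\<And>b. b \<noteq> a \<Longrightarrow> b \<noteq> prod.swap a \<Longrightarrow> v' b = v b"
  shows "first a v'"
proof -
  obtain n where n: "n < N" "a \<notin> B n v" "prod.swap a \<notin> B n v" "a \<in> B (Suc n) v"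
    using assms(1) by (auto simp: first_def)
  then have v: "\<And>b. b \<in> B n v \<Longrightarrow> v' b = v b" using assms(2) by metis
  have "B n v' = B n v" "B (Suc n) v' = B (Suc n) v"
    using B_cong[OF v, of n] B_cong[OF v, of "Suc n"] by auto
  then show ?thesis using n unfolding first_def by metis
qed

lemma first_cong:
  assumes "\<And>b. b \<noteq> a \<Longrightarrow> b \<noteq> prod.swap a \<Longrightarrow> v' b = v b"
  shows "first a v' \<longleftrightarrow> first a v"
  using first_cong_imp[of a v v'] first_cong_imp[of a v' v] assms by metis

lemma opened_step: "b \<in> B n v \<Longrightarrow> \<exists>m<n. b \<notin> B m v \<and> b \<in> B (Suc m) v"
proof (induction n)
  case (Suc n)
  then show ?case by (cases "b \<in> B n v") (auto intro: less_SucI)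
qed (simp add: B_0)

text \<open>The decision to open \<open>b\<close> is taken before its value is seen, and an opened
  box stays open.\<close>

lemma opened_cong_imp:
  assumes "b \<in> B N v" "\<And>b'. b' \<noteq> b \<Longrightarrow> v' b' = v b'"
  shows "b \<in> B N v'"
proof -
  obtain n where n: "n < N" "b \<notin> B n v" "b \<in> B (Suc n) v" using opened_step[OF assms(1)] by blast
  then have "\<And>b'. b' \<in> B n v \<Longrightarrow> v' b' = v b'" using assms(2) by metis
  then have "b \<in> B (Suc n) v'" using n B_predictable[of n v v'] by simp
  then show ?thesis using B_mono[of "Suc n" N v'] n(1) by auto
qed

lemma both_cong:
  assumes "\<And>b. b \<noteq> prod.swap a \<Longrightarrow> v' b = v b"
  shows "both a v' \<longleftrightarrow> both a v"
  using first_cong[of a v' v] opened_cong_imp[of "prod.swap a" v v']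
    opened_cong_imp[of "prod.swap a" v' v] assms unfolding both_def by metis

lemma first_opened: "first a v \<Longrightarrow> a \<in> B N v"
  unfolding first_def using B_mono Suc_leI by blast

lemma opened_first: "a \<in> B n v \<Longrightarrow> n \<le> N \<Longrightarrow> first a v \<or> first (prod.swap a) v"
proof -
  assume a: "a \<in> B n v" and n: "n \<le> N"
  \<comment> \<open>The least step at which a box of the edge is open. It is a successor because
    nothing is open at 0, and its predecessor is the witness for \<open>first\<close>.\<close>
  define m where "m = (LEAST m. a \<in> B m v \<or> prod.swap a \<in> B m v)"
  have m: "a \<in> B m v \<or> prod.swap a \<in> B m v" "m \<le> n"
    unfolding m_def using a by (metis (mono_tags, lifting) LeastI, auto intro: Least_le)
  then obtain k where k: "m = Suc k" using B_0 by (cases m) auto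
  then have "a \<notin> B k v" "prod.swap a \<notin> B k v"
    using not_less_Least[of k "\<lambda>m. a \<in> B m v \<or> prod.swap a \<in> B m v"] by (auto simp: m_def)
  then show ?thesis using m k n unfolding first_def
    by (metis Suc_le_lessD le_trans swap_swap)
qed

text \<open>The two witnessing steps would have to coincide, since opened sets grow, but one step
  opens at most one box.\<close>

lemma not_first_both:
  assumes "a \<in> boxes I" "first a v" shows "\<not> first (prod.swap a) v"
proof
  assume "first (prod.swap a) v"
  then obtain m where m: "a \<notin> B m v" "prod.swap a \<notin> B m v" "prod.swap a \<in> B (Suc m) v"
    by (auto simp: first_def)
  obtain n where n: "a \<notin> B n v" "prod.swap a \<notin> B n v" "a \<in> B (Suc n) v"
    using assms(2) by (auto simp: first_def)
  have "\<not> m < n" using m n B_mono[of "Suc m" n v] by auto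
  moreover have "\<not> n < m" using m n B_mono[of "Suc n" m v] by auto
  ultimately have "m = n" by simp
  then show False using m n B_single[of n v] swap_neq[OF assms(1)] by auto
qed

lemma matched_imp_both: "matched a v \<Longrightarrow> both a v"
  using M_open[of "snd a" "fst a" v] by (auto simp: matched_def both_def insert_commute prod.swap_def)

text \<open>Every opened box is either the first of its edge or follows its reverse. Reindexing the
  second kind by \<open>prod.swap\<close> collects both values and both costs of an edge at the box
  that was opened first.\<close>

lemma net_value_eq:
  "net_value I v (B N v, M v) = (\<Sum>a\<in>boxes I. of_bool (matched a v) * k3 a v -
     of_bool (first a v) * cost I a - of_bool (both a v) * cost I (prod.swap a))"
proof -
  have swap: "(\<Sum>a\<in>boxes I. X (prod.swap a)) = (\<Sum>a\<in>boxes I. X a)" for X :: "'v pbox \<Rightarrow> real"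
    by (rule sum.reindex_bij_witness[of _ prod.swap prod.swap]) auto
  have o: "of_bool (a \<in> B N v) = (of_bool (first a v) + of_bool (both (prod.swap a) v) :: real)"
    if "a \<in> boxes I" for a
    using opened_first[of a N v] first_opened[of a v] not_first_both[OF that, of v]
    by (auto simp: both_def)
  have m: "of_bool ({fst a, snd a} \<in> M v) = (of_bool (matched a v) + of_bool (matched (prod.swap a) v) :: real)"
    if "a \<in> boxes I" for a
    using opened_first[of a N v] M_open[of "fst a" "snd a" v] not_first_both[OF that, of v]
    by (auto simp: matched_def insert_commute)
  have "net_value I v (B N v, M v) =
    (\<Sum>a\<in>boxes I. of_bool ({fst a, snd a} \<in> M v) * v a - of_bool (a \<in> B N v) * cost I a)"
    unfolding net_value_def by (simp add: case_prod_unfold)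
  also have "\<dots> = (\<Sum>a\<in>boxes I. of_bool (matched a v) * v a) +
      (\<Sum>a\<in>boxes I. of_bool (matched (prod.swap a) v) * v a) -
      (\<Sum>a\<in>boxes I. of_bool (first a v) * cost I a) -
      (\<Sum>a\<in>boxes I. of_bool (both (prod.swap a) v) * cost I a)"
    by (simp add: o m algebra_simps sum.distrib sum_subtractf)
  also have "(\<Sum>a\<in>boxes I. of_bool (matched (prod.swap a) v) * v a) =
      (\<Sum>a\<in>boxes I. of_bool (matched a v) * v (prod.swap a))"
    using swap[of "\<lambda>a. of_bool (matched a v) * v (prod.swap a)"] by simp
  also have "(\<Sum>a\<in>boxes I. of_bool (both (prod.swap a) v) * cost I a) =
      (\<Sum>a\<in>boxes I. of_bool (both a v) * cost I (prod.swap a))"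
    using swap[of "\<lambda>a. of_bool (both a v) * cost I (prod.swap a)"] by simp
  finally show ?thesis
    by (simp add: k3_def algebra_simps sum.distrib sum_subtractf)
qed

lemma pred_measurable [measurable]:
  "Measurable.pred (value_space I) (first a)"
  "Measurable.pred (value_space I) (both a)"
  "Measurable.pred (value_space I) (matched a)"
proof -
  note [measurable] = B_measurable M_measurable
  show f [measurable]: "Measurable.pred (value_space I) (first a)"
    unfolding first_def[abs_def] by measurable
  show "Measurable.pred (value_space I) (both a)" unfolding both_def[abs_def] by measurable
  show "Measurable.pred (value_space I) (matched a)" unfolding matched_def[abs_def] by measurable
qed

text \<open>
  Since \<open>first a\<close> does not depend on the values of \<open>a\<close> and its reverse, and \<open>both a\<close> does not depend
  on the value of the reverse, each cost may be replaced by the excess that defines the index.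
\<close>

lemma amortized_welfare:
  "(\<integral>v. net_value I v (B N v, M v) \<partial>value_space I) =
    (\<integral>v. (\<Sum>a\<in>boxes I. of_bool (matched a v) * k3 a v -
     of_bool (first a v) * d1 a v - of_bool (both a v) * d2 a v) \<partial>value_space I)"
proof -
  have 1: "integrable (value_space I) (\<lambda>v. of_bool (matched a v) * k3 a v)"
    "integrable (value_space I) (\<lambda>v. of_bool (first a v) * d1 a v)"
    "integrable (value_space I) (\<lambda>v. of_bool (both a v) * d2 a v)" if "a \<in> boxes I" for a
    using that by (intro integrable_of_bool_mult integrable_k3 integrable_d1 integrable_d2; simp)+
  have 2: "(\<integral>v. of_bool (first a v) * d1 a v \<partial>value_space I) =
       (\<integral>v. of_bool (first a v) * cost I a \<partial>value_space I)" if "a \<in> boxes I" for a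
    by (rule has_bochner_integral_integral_eq[OF d1_integral[OF that]])
       (simp, (rule first_cong, simp)+)
  have 3: "(\<integral>v. of_bool (both a v) * d2 a v \<partial>value_space I) =
       (\<integral>v. of_bool (both a v) * cost I (prod.swap a) \<partial>value_space I)" if "a \<in> boxes I" for a
    by (rule has_bochner_integral_integral_eq[OF d2_integral[OF that]])
       (simp, rule both_cong, simp)
  have 4: "integrable (value_space I) (\<lambda>v. of_bool (first a v) * cost I a)"
    "integrable (value_space I) (\<lambda>v. of_bool (both a v) * cost I (prod.swap a))" for a
    by (intro integrable_of_bool_mult; simp)+
  show ?thesis
    unfolding net_value_eq using 1 2 3 4
    by (simp add: Bochner_Integration.integral_sum Bochner_Integration.integral_diff)
qed

lemma integrable_amortized:
  "integrable (value_space I) (\<lambda>v. \<Sum>a\<in>boxes I. of_bool (matched a v) * k3 a v -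
     of_bool (first a v) * d1 a v - of_bool (both a v) * d2 a v)"
  by (intro Bochner_Integration.integrable_sum Bochner_Integration.integrable_diff
      integrable_of_bool_mult integrable_k3 integrable_d1 integrable_d2) auto

text \<open>If the edge is matched, both charges are due and the two sides agree. Otherwise only
  nonpositive terms remain on the left.\<close>

lemma amortized_le:
  "of_bool (matched a v) * k3 a v - of_bool (first a v) * d1 a v - of_bool (both a v) * d2 a v
    \<le> of_bool (matched a v) * k1 a v"
proof -
  have "0 \<le> d1 a v" "0 \<le> d2 a v" by (simp_all add: d1_def d2_def)
  then show ?thesis
    using matched_imp_both[of a v] by (cases "matched a v") (auto simp: k1_def both_def)
qed

text \<open>Dropping \<open>first\<close> from \<open>matched\<close> counts each matched edge in
  both orientations; the positive part keeps this an upper bound. What remains of the policy is its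
  matching, so the order of opening need not be known.\<close>

lemma welfare_le:
  "(\<integral>v. net_value I v (B N v, M v) \<partial>value_space I) \<le>
    (\<Sum>a\<in>boxes I. \<integral>v. of_bool ({fst a, snd a} \<in> M v) * max 0 (k1 a v) \<partial>value_space I)"
proof -
  have int: "integrable (value_space I) (\<lambda>v. of_bool ({fst a, snd a} \<in> M v) * max 0 (k1 a v))"
    if "a \<in> boxes I" for a
    using integrable_k1[OF that] M_measurable by (intro integrable_of_bool_mult) auto
  have "(\<integral>v. net_value I v (B N v, M v) \<partial>value_space I) =
     (\<integral>v. (\<Sum>a\<in>boxes I. of_bool (matched a v) * k3 a v -
     of_bool (first a v) * d1 a v - of_bool (both a v) * d2 a v) \<partial>value_space I)"
    by (rule amortized_welfare)
  also have "\<dots> \<le> (\<integral>v. (\<Sum>a\<in>boxes I. of_bool ({fst a, snd a} \<in> M v) * max 0 (k1 a v)) \<partial>value_space I)"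
  proof (rule integral_mono[OF integrable_amortized])
    fix v
    show "(\<Sum>a\<in>boxes I. of_bool (matched a v) * k3 a v -
     of_bool (first a v) * d1 a v - of_bool (both a v) * d2 a v) \<le>
      (\<Sum>a\<in>boxes I. of_bool ({fst a, snd a} \<in> M v) * max 0 (k1 a v))"
      by (intro sum_mono order_trans[OF amortized_le]) (auto simp: matched_def of_bool_def)
  qed (use int in auto)
  finally show ?thesis using int by simp
qed

text \<open>The loss in \<open>amortized_le\<close> consists of charges paid for unmatched edges.
  The two assumptions say that these charges vanish.\<close>

lemma welfare_eq:
  assumes "\<And>a v. a \<in> boxes I \<Longrightarrow> first a v \<Longrightarrow> d1 a v > 0 \<Longrightarrow> {fst a, snd a} \<in> M v"
    and "\<And>a v. a \<in> boxes I \<Longrightarrow> both a v \<Longrightarrow> d2 a v > 0 \<Longrightarrow> {fst a, snd a} \<in> M v"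
  shows "(\<integral>v. net_value I v (B N v, M v) \<partial>value_space I) =
    (\<integral>v. (\<Sum>a\<in>boxes I. of_bool (matched a v) * k1 a v) \<partial>value_space I)"
proof -
  have "of_bool (matched a v) * k3 a v - of_bool (first a v) * d1 a v - of_bool (both a v) * d2 a v
      = of_bool (matched a v) * k1 a v" if a: "a \<in> boxes I" for a v
  proof (cases "matched a v")
    case True
    then show ?thesis using matched_imp_both[of a v] by (simp add: k1_def both_def)
  next
    case False
    then have "first a v \<longrightarrow> d1 a v = 0" "both a v \<longrightarrow> d2 a v = 0"
      using assms[OF a, of v] excess_nonneg unfolding matched_def both_def d1_def d2_def
      by (metis order_le_less)+
    then show ?thesis using False by auto
  qed
  then show ?thesis unfolding amortized_welfare by simp
qed

end

section \<open>Policies as explorations\<close>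

lemma measurable_count_space_subset:
  assumes "f \<in> M \<rightarrow>\<^sub>M count_space UNIV" "finite A" "\<And>x. x \<in> space M \<Longrightarrow> f x \<in> A"
  shows "f \<in> M \<rightarrow>\<^sub>M count_space A"
  using assms measurable_sets[OF assms(1)] by (auto simp: measurable_count_space_eq2)

lemma run_superset: "fst ` set h \<subseteq> fst (run p v n h)"
proof (induction n arbitrary: h)
  case (Suc n)
  show ?case
  proof (cases "p h")
    case (Open b)
    then show ?thesis using Suc[of "h @ [(b, v b)]"] by auto
  qed simp
qed simp

lemma run_Suc_mono: "fst (run p v n h) \<subseteq> fst (run p v (Suc n) h)"
proof (induction n arbitrary: h)
  case 0
  show ?case using run_superset[of h p v "Suc 0"] by simp
next
  case (Suc n)
  show ?case using Suc by (cases "p h") simp_all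
qed

lemma run_Suc_single: "\<exists>b. fst (run p v (Suc n) h) \<subseteq> insert b (fst (run p v n h))"
proof (induction n arbitrary: h)
  case 0
  show ?case by (cases "p h") auto
next
  case (Suc n)
  show ?case using Suc by (cases "p h") (auto simp del: run.simps simp: run.simps(2)[of p v "Suc n"] run.simps(2)[of p v n])
qed

text \<open>\<open>run\<close> recurses from the front while the additional step is at the far end,
  hence the induction over all histories. The box opened next belongs to the opened set, so both
  value vectors extend the history in the same way.\<close>

lemma run_predictable:
  "(\<And>b. b \<in> fst (run p v n h) \<Longrightarrow> v' b = v b) \<Longrightarrow>
     fst (run p v' (Suc n) h) = fst (run p v (Suc n) h)"
proof (induction n arbitrary: h)
  case 0
  show ?case by (cases "p h") auto
next
  case (Suc n)
  show ?case
  proof (cases "p h")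
    case (Open b)
    then have *: "fst (run p v (Suc n) h) = fst (run p v n (h @ [(b, v b)]))" by simp
    have "b \<in> fst (run p v (Suc n) h)"
      unfolding * using run_superset[of "h @ [(b, v b)]" p v n] by auto
    then have "v' b = v b" by (rule Suc.prems)
    moreover have "fst (run p v' (Suc n) (h @ [(b, v b)])) = fst (run p v (Suc n) (h @ [(b, v b)]))"
      using Suc.prems * by (intro Suc.IH) simp
    ultimately show ?thesis
      using Open by (simp only: run.simps(2)[of p _ "Suc n" h] action.case)
  qed simp
qed

text \<open>A policy whose internal randomness has been fixed. Only measurability in the values
  remains.\<close>

locale pandora_policy = pandora_indices I \<sigma>1 \<sigma>2
  for I :: "'v pandora" and \<sigma>1 :: "'v pbox \<Rightarrow> ereal" and \<sigma>2 :: "'v pbox \<Rightarrow> real \<Rightarrow> ereal" +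
  fixes p :: "'v history \<Rightarrow> 'v action"
  assumes valid: "distinct (map fst h) \<Longrightarrow> fst ` set h \<subseteq> boxes I \<Longrightarrow> valid_action I (fst ` set h) (p h)"
    and p_measurable: "distinct bs \<Longrightarrow> set bs \<subseteq> boxes I \<Longrightarrow>
      (\<lambda>v. p (map (\<lambda>b. (b, v b)) bs)) \<in> value_space I \<rightarrow>\<^sub>M count_space UNIV"
begin

lemma run_valid:
  "distinct (map fst h) \<Longrightarrow> fst ` set h \<subseteq> boxes I \<Longrightarrow> matching I (snd (run p v n h)) \<and>
    (\<forall>i j. {i, j} \<in> snd (run p v n h) \<longrightarrow> (i, j) \<in> fst (run p v n h))"
proof (induction n arbitrary: h)
  case 0
  show ?case by (simp add: matching_def)
next
  case (Suc n)
  show ?case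
  proof (cases "p h")
    case (Open b)
    then have "b \<in> boxes I" "b \<notin> fst ` set h" using valid[OF Suc.prems] by auto
    then show ?thesis using Open Suc.prems Suc.IH[of "h @ [(b, v b)]"] by simp
  next
    case (Stop M)
    then show ?thesis using valid[OF Suc.prems] by simp
  qed
qed

lemma run_measurable:
  "distinct bs \<Longrightarrow> set bs \<subseteq> boxes I \<Longrightarrow>
    (\<lambda>v. run p v n (map (\<lambda>b. (b, v b)) bs)) \<in> value_space I \<rightarrow>\<^sub>M count_space UNIV"
proof (induction n arbitrary: bs)
  case 0
  show ?case by (simp add: image_image)
next
  case (Suc n)
  \<comment> \<open>The valid actions form a finite set, so the run can be composed action by
    action, with each continuation measurable by induction.\<close>
  define T where "T = Open ` (boxes I - set bs) \<union> Stop ` Pow (edges I)"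
  define f where "f act v = (case act of Open b \<Rightarrow> run p v n (map (\<lambda>b. (b, v b)) (bs @ [b]))
    | Stop M \<Rightarrow> (set bs, M))" for act :: "'v action" and v
  have T: "p (map (\<lambda>b. (b, v b)) bs) \<in> T" for v
    using valid[of "map (\<lambda>b. (b, v b)) bs"] Suc.prems
    by (cases "p (map (\<lambda>b. (b, v b)) bs)") (auto simp: T_def matching_def image_image o_def)
  have "finite T" using finite_boxes finite_edges by (simp add: T_def)
  have "(\<lambda>v. f (p (map (\<lambda>b. (b, v b)) bs)) v) \<in> value_space I \<rightarrow>\<^sub>M count_space UNIV"
  proof (rule measurable_compose_countable'[where I = T])
    show "f act \<in> value_space I \<rightarrow>\<^sub>M count_space UNIV" if "act \<in> T" for act
    proof (cases act)
      case (Open b)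
      then show ?thesis using that Suc.IH[of "bs @ [b]"] Suc.prems
        by (auto simp: f_def[abs_def] T_def)
    qed (simp add: f_def[abs_def])
    show "(\<lambda>v. p (map (\<lambda>b. (b, v b)) bs)) \<in> value_space I \<rightarrow>\<^sub>M count_space T"
      using p_measurable[OF Suc.prems] \<open>finite T\<close> T by (rule measurable_count_space_subset)
    show "countable T" using \<open>finite T\<close> by (rule countable_finite)
  qed
  moreover have "run p v (Suc n) (map (\<lambda>b. (b, v b)) bs) = f (p (map (\<lambda>b. (b, v b)) bs)) v" for v
    by (simp add: f_def image_image split: action.split)
  ultimately show ?case by simp
qed

sublocale exploration I \<sigma>1 \<sigma>2 "\<lambda>n v. fst (run p v n [])" "card (boxes I) + 1"
  "\<lambda>v. snd (execute I p v)"
proof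
  have run [measurable]: "(\<lambda>v. run p v n []) \<in> value_space I \<rightarrow>\<^sub>M count_space UNIV" for n
    using run_measurable[of "[]" n] by simp
  show "Measurable.pred (value_space I) (\<lambda>v. b \<in> fst (run p v n []))" for b n
    by (rule measurable_compose[OF run, where g = "\<lambda>x. b \<in> fst x"]) simp
  show "Measurable.pred (value_space I) (\<lambda>v. e \<in> snd (execute I p v))" for e
    unfolding execute_def by (rule measurable_compose[OF run, where g = "\<lambda>x. e \<in> snd x"]) simp
  show "(i, j) \<in> fst (run p v (card (boxes I) + 1) [])" if "{i, j} \<in> snd (execute I p v)" for i j v
    using run_valid[of "[]" v "card (boxes I) + 1"] that by (simp add: execute_def)
qed (simp, rule run_Suc_mono, rule run_Suc_single, rule run_predictable)

lemma matching_execute: "matching I (snd (execute I p v))"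
  using run_valid[of "[]" v "card (boxes I) + 1"] by (simp add: execute_def)

end

section \<open>The descending procedure\<close>

lemma measurable_Collect_finite:
  assumes "finite S" and [measurable]: "\<And>a. a \<in> S \<Longrightarrow> Measurable.pred M (P a)"
  shows "(\<lambda>x. {a \<in> S. P a x}) \<in> M \<rightarrow>\<^sub>M count_space UNIV"
proof -
  have "(\<lambda>x. {a \<in> S. P a x}) \<in> M \<rightarrow>\<^sub>M count_space (Pow S)"
    unfolding measurable_count_space_eq2[OF iffD2[OF finite_Pow_iff assms(1)]]
  proof (intro conjI ballI)
    fix X assume "X \<in> Pow S"
    then have "(\<lambda>x. {a \<in> S. P a x}) -` {X} \<inter> space M = {x \<in> space M. \<forall>a\<in>S. P a x \<longleftrightarrow> a \<in> X}"
      by auto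
    also have "\<dots> \<in> sets M" using assms by (intro sets.sets_Collect_finite_All) auto
    finally show "(\<lambda>x. {a \<in> S. P a x}) -` {X} \<inter> space M \<in> sets M" .
  qed auto
  then show ?thesis by (rule measurable_compose) simp
qed

lemma sum_of_bool_subset:
  fixes f :: "'a \<Rightarrow> real"
  assumes "finite A" "S \<subseteq> A"
  shows "(\<Sum>a\<in>A. of_bool (a \<in> S) * f a) = sum f S"
proof -
  have "(\<Sum>a\<in>A. of_bool (a \<in> S) * f a) = (\<Sum>a\<in>A. if a \<in> S then f a else 0)"
    by (intro sum.cong) auto
  then show ?thesis using assms by (simp add: sum.inter_restrict[symmetric] Int_absorb1)
qed

section \<open>Greedy matchings are half optimal\<close>

abbreviation edge :: "'v pbox \<Rightarrow> 'v set" where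
  "edge a \<equiv> {fst a, snd a}"

lemma edge_eq_iff: "edge a = edge b \<longleftrightarrow> a = b \<or> a = prod.swap b"
  by (cases a; cases b) (auto simp: doubleton_eq_iff)

text \<open>Each endpoint of a chosen edge is charged by at most one edge of the other matching.\<close>

lemma greedy_half_optimal:
  fixes w :: "'v pbox \<Rightarrow> real"
  assumes ori: "finite ori" "\<And>a. a \<in> ori \<Longrightarrow> prod.swap a \<notin> ori"
    and M': "pairwise disjnt M'"
    and nonneg: "\<And>a. a \<in> ori \<Longrightarrow> edge a \<in> M \<Longrightarrow> 0 \<le> w a"
    and dom: "\<And>b. b \<in> ori \<Longrightarrow> 0 \<le> w b \<Longrightarrow>
      \<exists>a\<in>ori. edge a \<in> M \<and> edge a \<inter> edge b \<noteq> {} \<and> w b \<le> w a"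
  shows "(\<Sum>b\<in>ori. of_bool (edge b \<in> M') * max 0 (w b)) \<le> 2 * (\<Sum>a\<in>ori. of_bool (edge a \<in> M) * w a)"
proof -
  define W where "W a = of_bool (edge a \<in> M) * w a" for a
  \<comment> \<open>Whether \<open>b\<close> is in the competing matching and touches the endpoint
    \<open>x\<close>: the unit that \<open>b\<close> charges to \<open>x\<close>.\<close>
  define c where "c x b = (of_bool (x \<in> edge b \<and> edge b \<in> M') :: real)" for x b
  have W: "0 \<le> W a" if "a \<in> ori" for a using nonneg[OF that] by (simp add: W_def)
  \<comment> \<open>Disjointness of \<open>M'\<close> leaves one edge at \<open>x\<close>, and
    \<open>ori\<close> contains at most one orientation of it.\<close>
  have c1: "(\<Sum>b\<in>ori. c x b) \<le> 1" for x
  proof -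
    let ?C = "{b \<in> ori. x \<in> edge b \<and> edge b \<in> M'}"
    have eq: "b = b'" if "b \<in> ?C" "b' \<in> ?C" for b b'
    proof -
      have "edge b = edge b'"
        using that pairwiseD[OF M', of "edge b" "edge b'"] unfolding disjnt_iff by blast
      then show ?thesis using that ori(2)[of b'] unfolding edge_eq_iff by auto
    qed
    have fin: "finite ?C" using ori(1) by simp
    have "card ?C \<le> Suc 0" unfolding card_le_Suc0_iff_eq[OF fin] using eq by blast
    moreover have "(\<Sum>b\<in>ori. c x b) = real (card ?C)"
      using ori(1) by (simp add: c_def of_bool_def sum.If_cases Int_def)
    ultimately show ?thesis by simp
  qed
  have c2: "(\<Sum>b\<in>ori. c x b) + (\<Sum>b\<in>ori. c y b) \<le> 2" for x y
    using c1[of x] c1[of y] by linarith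
  have "(\<Sum>b\<in>ori. of_bool (edge b \<in> M') * max 0 (w b)) \<le>
      (\<Sum>b\<in>ori. \<Sum>a\<in>ori. W a * (c (fst a) b + c (snd a) b))"
  proof (rule sum_mono)
    fix b assume b: "b \<in> ori"
    have *: "0 \<le> W a * (c (fst a) b + c (snd a) b)" if "a \<in> ori" for a
      using W[OF that] by (simp add: c_def)
    show "of_bool (edge b \<in> M') * max 0 (w b) \<le> (\<Sum>a\<in>ori. W a * (c (fst a) b + c (snd a) b))"
    proof (cases "edge b \<in> M' \<and> 0 \<le> w b")
      case True
      then obtain a where a: "a \<in> ori" "edge a \<in> M" "edge a \<inter> edge b \<noteq> {}" "w b \<le> w a"
        using dom[OF b] by blast
      \<comment> \<open>The shared vertex is an endpoint of \<open>a\<close>, so \<open>b\<close>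
        charges at least one of the two endpoints of its dominator.\<close>
      have "1 \<le> c (fst a) b + c (snd a) b" using True a(3) by (auto simp: c_def)
      then have "W a * 1 \<le> W a * (c (fst a) b + c (snd a) b)"
        using W[OF a(1)] by (intro mult_left_mono) auto
      also have "\<dots> \<le> (\<Sum>a\<in>ori. W a * (c (fst a) b + c (snd a) b))"
        using a(1) ori(1) * by (intro member_le_sum) auto
      finally show ?thesis using True a by (simp add: W_def)
    next
      case False
      then have "of_bool (edge b \<in> M') * max 0 (w b) = 0" by auto
      then show ?thesis using * by (simp add: sum_nonneg)
    qed
  qed
  also have "\<dots> = (\<Sum>a\<in>ori. W a * ((\<Sum>b\<in>ori. c (fst a) b) + (\<Sum>b\<in>ori. c (snd a) b)))"
    by (subst sum.swap) (simp add: distrib_left sum.distrib sum_distrib_left)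
  also have "\<dots> \<le> (\<Sum>a\<in>ori. W a * 2)"
    using W c2 by (intro sum_mono mult_left_mono) auto
  also have "\<dots> = 2 * (\<Sum>a\<in>ori. W a)" by (simp add: sum_distrib_right[symmetric])
  finally show ?thesis by (simp add: W_def)
qed

text \<open>The orientation is fixed; its randomness returns only when the resulting bounds are
  averaged. \<open>ori_card\<close> ensures that the prescribed number of steps is enough for the
  procedure to stop.\<close>

locale descent = pandora_indices I \<sigma>1 \<sigma>2
  for I :: "'v pandora" and \<sigma>1 :: "'v pbox \<Rightarrow> ereal" and \<sigma>2 :: "'v pbox \<Rightarrow> real \<Rightarrow> ereal" +
  fixes tie :: "'v state \<Rightarrow> 'v pbox set \<Rightarrow> 'v pbox" and ori :: "'v pbox set"
  assumes tie: "tie_breaking tie"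
    and ori_boxes: "ori \<subseteq> boxes I"
    and ori_swap: "a \<in> ori \<Longrightarrow> prod.swap a \<notin> ori"
    and ori_card: "card ori \<le> card (edges I)"
begin

abbreviation cur :: "('v pbox \<Rightarrow> real) \<Rightarrow> 'v pbox set \<Rightarrow> 'v pbox \<Rightarrow> ereal" where
  "cur \<equiv> current_index \<sigma>1 \<sigma>2"

abbreviation step :: "('v pbox \<Rightarrow> real) \<Rightarrow> 'v state \<Rightarrow> 'v state" where
  "step \<equiv> descending_step tie \<sigma>1 \<sigma>2"

definition st :: "nat \<Rightarrow> ('v pbox \<Rightarrow> real) \<Rightarrow> 'v state" where
  "st n v = (step v ^^ n) ({}, ori, {})"

lemma st_0 [simp]: "st 0 v = ({}, ori, {})"
  and st_Suc [simp]: "st (Suc n) v = step v (st n v)"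
  by (simp_all add: st_def)

lemma finite_ori: "finite ori"
  using ori_boxes finite_boxes by (rule finite_subset)

lemma cur_eq: "cur v B a =
    (if a \<notin> B then \<sigma>1 a else if prod.swap a \<notin> B then \<sigma>2 a (v a) else ereal (k3 a v))"
  by (cases a) (simp add: current_index_def k3_def kappa3_def)

text \<open>Whatever its stage, a basket's current index is one of the three entries of the minimum
  \<open>K1\<close>.\<close>

lemma K1_le_cur: "K1 a v \<le> cur v B a"
  by (auto simp: cur_eq K1_def K2_def intro: min.coboundedI1 min.coboundedI2)

lemma advance_eq: "advance a (B, S, M) =
    (if a \<notin> B then (insert a B, S, M)
     else if prod.swap a \<notin> B then (insert (prod.swap a) B, S, M)
     else (B, {b \<in> S. edge b \<inter> edge a = {}}, insert (edge a) M))"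
  by (cases a) (auto simp: case_prod_unfold)

lemma advance_single: "\<exists>b. fst (advance a (B, S, M)) \<subseteq> insert b B"
  unfolding advance_eq by (auto simp del: split_paired_Ex)

definition stopped :: "('v pbox \<Rightarrow> real) \<Rightarrow> 'v state \<Rightarrow> bool" where
  "stopped v = (\<lambda>(B, S, M). \<forall>a\<in>S. cur v B a < 0)"

lemma step_stopped: "stopped v s \<Longrightarrow> step v s = s"
  by (cases s) (simp add: stopped_def Let_def)

lemma step_advance:
  assumes "finite S" "\<not> stopped v (B, S, M)"
  obtains a where "a \<in> S" "\<forall>b\<in>S. cur v B b \<le> cur v B a" "0 \<le> cur v B a"
    "step v (B, S, M) = advance a (B, S, M)"
proof -
  let ?A = "{a \<in> S. \<forall>a'\<in>S. cur v B a' \<le> cur v B a}"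
  define a where "a = tie (B, S, M) ?A"
  obtain a0 where a0: "a0 \<in> S" "\<not> cur v B a0 < 0" using assms(2) by (auto simp: stopped_def)
  have "Max (cur v B ` S) \<in> cur v B ` S" using assms(1) a0 by (intro Max_in) auto
  then obtain m where "m \<in> S" "cur v B m = Max (cur v B ` S)" by force
  then have "m \<in> ?A" using assms(1) by simp
  then have "?A \<noteq> {}" by blast
  then have a: "a \<in> ?A"
    unfolding a_def by (rule tie[unfolded tie_breaking_def, rule_format])
  then have "cur v B a0 \<le> cur v B a" using a0(1) by blast
  then have "0 \<le> cur v B a" using a0(2) by (meson not_less order_trans)
  moreover have "step v (B, S, M) = advance a (B, S, M)"
    using a0 unfolding a_def descending_step.simps Let_def by (subst if_not_P) blast+
  ultimately show thesis using that[of a] a by blast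
qed

text \<open>
  The bounds by \<open>\<sigma>1\<close> and \<open>\<sigma>2\<close> in the fourth and fifth conjunct record that a basket had the largest
  index when it was advanced; together with the sixth they make the procedure greedy for \<open>K1\<close>. By the
  last two conjuncts, a basket whose remaining value exceeds an index it has passed is already
  matched or stays strictly ahead of all others.
\<close>

definition invariant :: "('v pbox \<Rightarrow> real) \<Rightarrow> 'v state \<Rightarrow> bool" where
  "invariant v = (\<lambda>(B, S, M).
     S \<subseteq> ori \<and> (\<forall>b\<in>B. b \<in> ori \<or> prod.swap b \<in> ori) \<and>
     (\<forall>e\<in>M. \<exists>a\<in>ori. e = edge a \<and> a \<in> B \<and> prod.swap a \<in> B \<and> 0 \<le> K1 a v) \<and>
     (\<forall>a\<in>ori. a \<in> B \<longrightarrow> 0 \<le> \<sigma>1 a \<and> (\<forall>b\<in>S. K1 b v \<le> \<sigma>1 a)) \<and>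
     (\<forall>a\<in>ori. prod.swap a \<in> B \<longrightarrow> a \<in> B \<and> 0 \<le> \<sigma>2 a (v a) \<and> (\<forall>b\<in>S. K1 b v \<le> \<sigma>2 a (v a))) \<and>
     (\<forall>b\<in>ori - S. \<exists>a\<in>ori. edge a \<in> M \<and> edge a \<inter> edge b \<noteq> {} \<and> K1 b v \<le> K1 a v) \<and>
     (\<forall>a\<in>ori. edge a \<notin> M \<longrightarrow> a \<in> B \<longrightarrow> \<sigma>1 a < K2 a v \<longrightarrow>
        a \<in> S \<and> (\<forall>b\<in>S - {a}. cur v B b \<le> \<sigma>1 a)) \<and>
     (\<forall>a\<in>ori. edge a \<notin> M \<longrightarrow> prod.swap a \<in> B \<longrightarrow> \<sigma>2 a (v a) < ereal (k3 a v) \<longrightarrow>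
        a \<in> S \<and> (\<forall>b\<in>S - {a}. cur v B b \<le> \<sigma>2 a (v a))))"

lemma invariantD:
  assumes "invariant v (B, S, M)"
  shows "S \<subseteq> ori" and "\<forall>b\<in>B. b \<in> ori \<or> prod.swap b \<in> ori"
    and "\<forall>e\<in>M. \<exists>a\<in>ori. e = edge a \<and> a \<in> B \<and> prod.swap a \<in> B \<and> 0 \<le> K1 a v"
    and "\<forall>a\<in>ori. a \<in> B \<longrightarrow> 0 \<le> \<sigma>1 a \<and> (\<forall>b\<in>S. K1 b v \<le> \<sigma>1 a)"
    and "\<forall>a\<in>ori. prod.swap a \<in> B \<longrightarrow> a \<in> B \<and> 0 \<le> \<sigma>2 a (v a) \<and> (\<forall>b\<in>S. K1 b v \<le> \<sigma>2 a (v a))"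
    and "\<forall>b\<in>ori - S. \<exists>a\<in>ori. edge a \<in> M \<and> edge a \<inter> edge b \<noteq> {} \<and> K1 b v \<le> K1 a v"
    and "\<forall>a\<in>ori. edge a \<notin> M \<longrightarrow> a \<in> B \<longrightarrow> \<sigma>1 a < K2 a v \<longrightarrow>
        a \<in> S \<and> (\<forall>b\<in>S - {a}. cur v B b \<le> \<sigma>1 a)"
    and "\<forall>a\<in>ori. edge a \<notin> M \<longrightarrow> prod.swap a \<in> B \<longrightarrow> \<sigma>2 a (v a) < ereal (k3 a v) \<longrightarrow>
        a \<in> S \<and> (\<forall>b\<in>S - {a}. cur v B b \<le> \<sigma>2 a (v a))"
  using assms unfolding invariant_def prod.case by - (elim conjE, assumption)+

lemma invariant_initial: "invariant v ({}, ori, {})"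
  by (simp add: invariant_def)

text \<open>The three cases are the three effects of an advance. What makes them work is that only
  the advanced basket can be exposed, that is, unmatched with a remaining value above an index it
  has passed.\<close>

lemma invariant_step:
  assumes inv: "invariant v (B, S, M)"
  shows "invariant v (step v (B, S, M))"
proof (cases "stopped v (B, S, M)")
  case True
  then show ?thesis using inv by (simp only: step_stopped)
next
  case False
  note S = invariantD(1)[OF inv]
  then have "finite S" using finite_ori by (rule finite_subset)
  then obtain a where a: "a \<in> S" "\<forall>b\<in>S. cur v B b \<le> cur v B a" "0 \<le> cur v B a"
    and step: "step v (B, S, M) = advance a (B, S, M)"
    using False by (rule step_advance)
  note ao = subsetD[OF S a(1)]
  note i1 = invariantD(2)[OF inv] and i2 = invariantD(3)[OF inv]
    and i3 = invariantD(4)[OF inv, rule_format] and i4 = invariantD(5)[OF inv, rule_format]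
    and i5 = invariantD(6)[OF inv, THEN bspec]
    and i6 = invariantD(7)[OF inv, rule_format] and i7 = invariantD(8)[OF inv, rule_format]
  have K1_cur: "K1 b v \<le> cur v B a" if "b \<in> S" for b
    using K1_le_cur bspec[OF a(2) that] by (rule order_trans)
  \<comment> \<open>For any other basket \<open>c\<close> the invariant would bound the index of
    \<open>a\<close> by \<open>\<sigma>1 c\<close>, which is strictly below the index of
    \<open>c\<close>. This contradicts the maximality of \<open>a\<close>.\<close>
  have exposed1: "c = a" if c: "c \<in> ori" "edge c \<notin> M" "c \<in> B" "\<sigma>1 c < K2 c v" for c
  proof (rule ccontr)
    assume "c \<noteq> a"
    then have "c \<in> S" "cur v B a \<le> \<sigma>1 c" using i6[OF c] a(1) by auto
    moreover have "\<sigma>1 c < cur v B c" using c(3,4) by (auto simp: cur_eq K2_def)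
    ultimately show False using a(2) by force
  qed
  have exposed2: "c = a" if c: "c \<in> ori" "edge c \<notin> M" "prod.swap c \<in> B" "\<sigma>2 c (v c) < ereal (k3 c v)" for c
  proof (rule ccontr)
    assume "c \<noteq> a"
    then have "c \<in> S" "cur v B a \<le> \<sigma>2 c (v c)" using i7[OF c] a(1) by auto
    moreover have "\<sigma>2 c (v c) < cur v B c" using c(3,4) i4[OF c(1,3)] by (auto simp: cur_eq)
    ultimately show False using a(2) by force
  qed
  \<comment> \<open>\<open>ori\<close> contains no second orientation of the edge of
    \<open>a\<close>, so opening one of its boxes changes no other index.\<close>
  have cur_other: "cur v (insert x B) b = cur v B b" if "b \<in> S" "b \<noteq> a" "x = a \<or> x = prod.swap a" for b x
  proof -
    have "b \<noteq> x" "prod.swap b \<noteq> x"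
      using that S ao ori_swap[of a] ori_swap[of b] by (metis subsetD swap_swap)+
    then show ?thesis by (auto simp: cur_eq)
  qed
  have sw: "prod.swap c \<noteq> a" if "c \<in> ori" for c using ori_swap[OF that] ao by auto
  have sw': "c \<noteq> prod.swap a" if "c \<in> ori" for c using ori_swap[OF ao] that by auto
  consider "a \<notin> B" | "a \<in> B" "prod.swap a \<notin> B" | "a \<in> B" "prod.swap a \<in> B" by blast
  then show ?thesis
  proof cases
    case 1
    then have c: "cur v B a = \<sigma>1 a" by (simp add: cur_eq)
    have 3: "\<forall>c\<in>ori. c \<in> insert a B \<longrightarrow> 0 \<le> \<sigma>1 c \<and> (\<forall>b\<in>S. K1 b v \<le> \<sigma>1 c)"
      using i3 a(3) K1_cur c by auto
    have 4: "\<forall>a'\<in>ori. prod.swap a' \<in> insert a B \<longrightarrow> a' \<in> insert a B \<and> 0 \<le> \<sigma>2 a' (v a') \<and>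
        (\<forall>b\<in>S. K1 b v \<le> \<sigma>2 a' (v a'))"
      using i4 sw by auto
    have 6: "\<forall>a'\<in>ori. edge a' \<notin> M \<longrightarrow> a' \<in> insert a B \<longrightarrow> \<sigma>1 a' < K2 a' v \<longrightarrow>
        a' \<in> S \<and> (\<forall>b\<in>S - {a'}. cur v (insert a B) b \<le> \<sigma>1 a')"
    proof (intro ballI impI)
      fix a' assume *: "a' \<in> ori" "edge a' \<notin> M" "a' \<in> insert a B" "\<sigma>1 a' < K2 a' v"
      have "a' = a" using exposed1[OF *(1,2) _ *(4)] *(3) by blast
      then show "a' \<in> S \<and> (\<forall>b\<in>S - {a'}. cur v (insert a B) b \<le> \<sigma>1 a')"
        using a c cur_other by auto
    qed
    have 7: "\<forall>a'\<in>ori. edge a' \<notin> M \<longrightarrow> prod.swap a' \<in> insert a B \<longrightarrow> \<sigma>2 a' (v a') < ereal (k3 a' v) \<longrightarrow>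
        a' \<in> S \<and> (\<forall>b\<in>S - {a'}. cur v (insert a B) b \<le> \<sigma>2 a' (v a'))"
    proof (intro ballI impI)
      fix a' assume *: "a' \<in> ori" "edge a' \<notin> M" "prod.swap a' \<in> insert a B" "\<sigma>2 a' (v a') < ereal (k3 a' v)"
      have "prod.swap a' \<in> B" using *(3) sw[OF *(1)] by auto
      \<comment> \<open>This contradicts \<open>a \<notin> B\<close>: while the first box is closed,
        nothing can be exposed at the second index.\<close>
      then have "a' = a" "a' \<in> B" using exposed2[OF *(1,2) _ *(4)] i4[OF *(1)] by auto
      then show "a' \<in> S \<and> (\<forall>b\<in>S - {a'}. cur v (insert a B) b \<le> \<sigma>2 a' (v a'))" using 1 by simp
    qed
    show ?thesis unfolding step advance_eq invariant_def using 1 S i1 i2 i5 ao 3 4 6 7 by auto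
  next
    case 2
    let ?B = "insert (prod.swap a) B"
    have c: "cur v B a = \<sigma>2 a (v a)" using 2 by (simp add: cur_eq)
    have 3: "\<forall>c\<in>ori. c \<in> ?B \<longrightarrow> 0 \<le> \<sigma>1 c \<and> (\<forall>b\<in>S. K1 b v \<le> \<sigma>1 c)"
      using i3 sw' by auto
    have 4: "\<forall>a'\<in>ori. prod.swap a' \<in> ?B \<longrightarrow> a' \<in> ?B \<and> 0 \<le> \<sigma>2 a' (v a') \<and>
        (\<forall>b\<in>S. K1 b v \<le> \<sigma>2 a' (v a'))"
    proof (intro ballI impI)
      fix a' assume *: "a' \<in> ori" "prod.swap a' \<in> ?B"
      show "a' \<in> ?B \<and> 0 \<le> \<sigma>2 a' (v a') \<and> (\<forall>b\<in>S. K1 b v \<le> \<sigma>2 a' (v a'))"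
      proof (cases "prod.swap a' \<in> B")
        case True
        then show ?thesis using i4[OF *(1)] by auto
      next
        case False
        then have "a' = a" using * by (metis insertE swap_swap)
        then show ?thesis using 2 a(3) c K1_cur by auto
      qed
    qed
    have 6: "\<forall>a'\<in>ori. edge a' \<notin> M \<longrightarrow> a' \<in> ?B \<longrightarrow> \<sigma>1 a' < K2 a' v \<longrightarrow>
        a' \<in> S \<and> (\<forall>b\<in>S - {a'}. cur v ?B b \<le> \<sigma>1 a')"
    proof (intro ballI impI)
      fix a' assume *: "a' \<in> ori" "edge a' \<notin> M" "a' \<in> ?B" "\<sigma>1 a' < K2 a' v"
      have "a' \<in> B" using *(3) sw'[OF *(1)] by auto
      then have "a' = a" using exposed1[OF *(1,2) _ *(4)] by blast
      then show "a' \<in> S \<and> (\<forall>b\<in>S - {a'}. cur v ?B b \<le> \<sigma>1 a')"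
        using i6[OF *(1,2) \<open>a' \<in> B\<close> *(4)] cur_other by auto
    qed
    have 7: "\<forall>a'\<in>ori. edge a' \<notin> M \<longrightarrow> prod.swap a' \<in> ?B \<longrightarrow> \<sigma>2 a' (v a') < ereal (k3 a' v) \<longrightarrow>
        a' \<in> S \<and> (\<forall>b\<in>S - {a'}. cur v ?B b \<le> \<sigma>2 a' (v a'))"
    proof (intro ballI impI)
      fix a' assume *: "a' \<in> ori" "edge a' \<notin> M" "prod.swap a' \<in> ?B" "\<sigma>2 a' (v a') < ereal (k3 a' v)"
      have "a' = a" using exposed2[OF *(1,2) _ *(4)] *(3) by (metis insertE swap_swap)
      then show "a' \<in> S \<and> (\<forall>b\<in>S - {a'}. cur v ?B b \<le> \<sigma>2 a' (v a'))"
        using a c cur_other by auto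
    qed
    show ?thesis unfolding step advance_eq invariant_def using 2 S i1 i2 i5 ao 3 4 6 7 by auto
  next
    case 3
    let ?S = "{b \<in> S. edge b \<inter> edge a = {}}" and ?M = "insert (edge a) M"
    have c: "cur v B a = ereal (k3 a v)" using 3 by (simp add: cur_eq)
    have "0 \<le> K1 a v" using i3[OF ao 3(1)] i4[OF ao 3(2)] a(3) c by (simp add: K1_def K2_def)
    then have 2: "\<forall>e\<in>?M. \<exists>a\<in>ori. e = edge a \<and> a \<in> B \<and> prod.swap a \<in> B \<and> 0 \<le> K1 a v"
      using i2 3 ao by blast
    have 5: "\<forall>b\<in>ori - ?S. \<exists>a\<in>ori. edge a \<in> ?M \<and> edge a \<inter> edge b \<noteq> {} \<and> K1 b v \<le> K1 a v"
    proof
      fix b assume b: "b \<in> ori - ?S"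
      show "\<exists>a\<in>ori. edge a \<in> ?M \<and> edge a \<inter> edge b \<noteq> {} \<and> K1 b v \<le> K1 a v"
      proof (cases "b \<in> S")
        \<comment> \<open>A basket removed just now. \<open>K1 a\<close> is the minimum of
          \<open>\<sigma>1 a\<close>, \<open>\<sigma>2 a\<close> and \<open>k3 a\<close>; the
          invariant bounds \<open>K1 b\<close> by the first two, and maximality of the present index
          by the third.\<close>
        case True
        then have "K1 b v \<le> K1 a v"
          using i3[OF ao 3(1)] i4[OF ao 3(2)] K1_cur[OF True] c
          unfolding K1_def[of a] K2_def[of a] by simp
        moreover have "edge a \<inter> edge b \<noteq> {}" using b True by blast
        ultimately show ?thesis using ao by blast
      next
        case False
        then show ?thesis using i5[of b] b by blast
      qed
    qed
    \<comment> \<open>Only \<open>a\<close> could be exposed, and it has just been matched, so the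
      last two conjuncts become vacuous.\<close>
    have 6: "\<not> \<sigma>1 a' < K2 a' v" if "a' \<in> ori" "edge a' \<notin> ?M" "a' \<in> B" for a'
      using exposed1[of a'] that by blast
    have 7: "\<not> \<sigma>2 a' (v a') < ereal (k3 a' v)" if "a' \<in> ori" "edge a' \<notin> ?M" "prod.swap a' \<in> B" for a'
      using exposed2[of a'] that by blast
    have "step v (B, S, M) = (B, ?S, ?M)" unfolding step advance_eq using 3 by simp
    moreover have "invariant v (B, ?S, ?M)"
      unfolding invariant_def prod.case
    proof (intro conjI)
      show "?S \<subseteq> ori" using S by blast
      show "\<forall>a\<in>ori. a \<in> B \<longrightarrow> 0 \<le> \<sigma>1 a \<and> (\<forall>b\<in>?S. K1 b v \<le> \<sigma>1 a)"
        using i3 by simp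
      show "\<forall>a\<in>ori. prod.swap a \<in> B \<longrightarrow>
          a \<in> B \<and> 0 \<le> \<sigma>2 a (v a) \<and> (\<forall>b\<in>?S. K1 b v \<le> \<sigma>2 a (v a))"
        using i4 by simp
    qed (fact i1, fact 2, fact 5, use 6 in simp, use 7 in simp)
    ultimately show ?thesis by simp
  qed
qed

lemma invariant_st: "invariant v (st n v)"
proof (induction n)
  case 0
  show ?case by (simp add: invariant_initial)
next
  case (Suc n)
  then show ?case using invariant_step by (cases "st n v") (simp del: descending_step.simps)
qed

text \<open>The number of times that the remaining baskets can still be advanced.\<close>

definition potential :: "'v state \<Rightarrow> nat" where
  "potential = (\<lambda>(B, S, M). \<Sum>c\<in>S. 1 + of_bool (c \<notin> B) + of_bool (prod.swap c \<notin> B))"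

lemma potential_step:
  assumes S: "S \<subseteq> ori" and ns: "\<not> stopped v (B, S, M)"
  shows "potential (step v (B, S, M)) < potential (B, S, M)"
proof -
  have fin: "finite S" using S finite_ori by (rule finite_subset)
  then obtain a where a: "a \<in> S" and step: "step v (B, S, M) = advance a (B, S, M)"
    using ns by (rule step_advance)
  consider "a \<notin> B" | "a \<in> B" "prod.swap a \<notin> B" | "a \<in> B" "prod.swap a \<in> B" by blast
  then show ?thesis
  proof cases
    case 1
    then show ?thesis unfolding step advance_eq potential_def
      using a fin by (auto intro!: sum_strict_mono_ex1 bexI[of _ a])
  next
    case 2
    then show ?thesis unfolding step advance_eq potential_def
      using a fin by (auto intro!: sum_strict_mono_ex1 bexI[of _ a])
  next
    case 3
    then show ?thesis unfolding step advance_eq potential_def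
      using a fin by (auto intro!: sum_strict_mono2[of _ _ a])
  qed
qed

lemma stopped_final: "stopped v (st (3 * card (edges I)) v)"
proof -
  have *: "stopped v (st n v) \<or> potential (st n v) + n \<le> 3 * card ori" for n
  proof (induction n)
    case 0
    have "potential ({}, ori, {}) = 3 * card ori" by (simp add: potential_def)
    then show ?case by simp
  next
    case (Suc n)
    obtain B S M where s: "st n v = (B, S, M)" by (cases "st n v")
    have "S \<subseteq> ori" using invariantD(1)[of v B S M] invariant_st[of v n] by (simp add: s)
    show ?case
    proof (cases "stopped v (st n v)")
      case True
      then show ?thesis by (simp add: step_stopped)
    next
      case False
      then show ?thesis using Suc potential_step[OF \<open>S \<subseteq> ori\<close>, of v B M]
        by (simp add: s del: descending_step.simps)
    qed
  qed
  obtain B S M where s: "st (3 * card (edges I)) v = (B, S, M)"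
    by (cases "st (3 * card (edges I)) v")
  have "finite S"
    using invariantD(1)[OF invariant_st[of v "3 * card (edges I)", unfolded s]] finite_ori by (rule finite_subset)
  \<comment> \<open>Each remaining basket adds at least 1 to the potential. Potential 0 thus means
    that no basket remains, which also counts as stopped.\<close>
  moreover have "stopped v (B, S, M) \<or> potential (B, S, M) = 0"
    using *[of "3 * card (edges I)"] ori_card by (auto simp: s)
  ultimately show ?thesis
    by (auto simp: s potential_def stopped_def)
qed

section \<open>Predictability and measurability of the procedure\<close>

lemma cur_cong: "(\<And>b. b \<in> B \<Longrightarrow> v' b = v b) \<Longrightarrow> cur v' B = cur v B"
  by (rule ext) (simp add: cur_eq k3_def)

lemma step_cong:
  assumes "\<And>b. b \<in> fst s \<Longrightarrow> v' b = v b"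
  shows "step v' s = step v s"
proof -
  obtain B S M where s: "s = (B, S, M)" by (cases s)
  have "cur v' B = cur v B" using assms by (intro cur_cong) (simp add: s)
  then show ?thesis unfolding s descending_step.simps by simp
qed

lemma step_mono: "fst s \<subseteq> fst (step v s)"
  by (cases s) (auto simp: Let_def advance_eq simp del: advance.simps)

lemma st_cong: "(\<And>b. b \<in> fst (st n v) \<Longrightarrow> v' b = v b) \<Longrightarrow> st (Suc n) v' = st (Suc n) v"
proof (induction n)
  case 0
  show ?case unfolding st_Suc st_0 by (rule step_cong) simp
next
  case (Suc n)
  have e: "st (Suc n) v' = st (Suc n) v"
  proof (rule Suc.IH)
    fix b assume "b \<in> fst (st n v)"
    then have "b \<in> fst (st (Suc n) v)" unfolding st_Suc by (rule subsetD[OF step_mono])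
    then show "v' b = v b" by (rule Suc.prems)
  qed
  have "step v' (st (Suc n) v) = step v (st (Suc n) v)" using Suc.prems by (rule step_cong)
  then show ?case unfolding st_Suc[of "Suc n"] e .
qed

lemma cur_measurable: "a \<in> boxes I \<Longrightarrow> (\<lambda>v. cur v B a) \<in> borel_measurable (value_space I)"
proof -
  assume a: "a \<in> boxes I"
  have "(\<lambda>v. \<sigma>2 a (v a)) \<in> borel_measurable (value_space I)"
    by (rule measurable_compose[OF component_measurable[OF a] \<sigma>2_measurable[OF a]])
  moreover have "(\<lambda>v. ereal (k3 a v)) \<in> borel_measurable (value_space I)"
    by (rule borel_measurable_ereal[OF k_measurable(1)[OF a]])
  ultimately show ?thesis
    unfolding cur_eq by (cases "a \<in> B"; cases "prod.swap a \<in> B") simp_all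
qed

text \<open>For a fixed state the values enter only through the comparisons of indices. The set of
  maximal baskets is therefore measurable into a discrete space, where composition with the
  arbitrary \<open>tie\<close> is harmless.\<close>

lemma step_measurable:
  assumes "S \<subseteq> boxes I"
  shows "(\<lambda>v. step v (B, S, M)) \<in> value_space I \<rightarrow>\<^sub>M count_space UNIV"
proof -
  have S: "finite S" using assms finite_boxes by (rule finite_subset)
  have cm: "(\<lambda>v. cur v B a) \<in> borel_measurable (value_space I)" if "a \<in> S" for a
    using assms that by (intro cur_measurable) auto
  define A where "A v = {a \<in> S. \<forall>a'\<in>S. cur v B a' \<le> cur v B a}" for v
  have "A \<in> value_space I \<rightarrow>\<^sub>M count_space UNIV"
    unfolding A_def[abs_def]
  proof (rule measurable_Collect_finite[OF S])
    fix a assume a: "a \<in> S"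
    show "Measurable.pred (value_space I) (\<lambda>v. \<forall>a'\<in>S. cur v B a' \<le> cur v B a)"
    proof (rule pred_intros_finite(3)[OF S])
      fix a' assume "a' \<in> S"
      show "Measurable.pred (value_space I) (\<lambda>v. cur v B a' \<le> cur v B a)"
        unfolding pred_def by (rule borel_measurable_le[OF cm[OF \<open>a' \<in> S\<close>] cm[OF a]])
    qed
  qed
  then have [measurable]: "(\<lambda>v. advance (tie (B, S, M) (A v)) (B, S, M)) \<in>
      value_space I \<rightarrow>\<^sub>M count_space UNIV"
    by (rule measurable_compose) simp
  have [measurable]: "Measurable.pred (value_space I) (\<lambda>v. \<forall>a\<in>S. cur v B a < 0)"
  proof (rule pred_intros_finite(3)[OF S])
    fix a assume "a \<in> S"
    then show "Measurable.pred (value_space I) (\<lambda>v. cur v B a < 0)"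
      unfolding pred_def by (intro borel_measurable_less cm borel_measurable_const)
  qed
  show ?thesis
    unfolding descending_step.simps Let_def A_def[symmetric] by measurable
qed

lemma st_measurable: "st n \<in> value_space I \<rightarrow>\<^sub>M count_space UNIV"
proof (induction n)
  case 0
  show ?case by (simp add: st_def[abs_def])
next
  case (Suc n)
  \<comment> \<open>By the invariant all reachable states lie in this finite set, so the step can be
    treated state by state.\<close>
  define T where "T = Pow (boxes I) \<times> Pow (boxes I) \<times> Pow (edges I)"
  have T: "st n v \<in> T" for v
  proof -
    obtain B S M where s: "st n v = (B, S, M)" by (cases "st n v")
    note inv = invariant_st[of v n, unfolded s]
    have "edge a \<in> edges I" if "a \<in> ori" for a
      using that ori_boxes by (auto simp: boxes_def)
    then have "M \<subseteq> edges I" using invariantD(3)[OF inv] by (metis subsetI)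
    moreover have "B \<subseteq> boxes I"
      using invariantD(2)[OF inv] ori_boxes by (metis subsetD subsetI swap_in_boxes)
    moreover have "S \<subseteq> boxes I" using invariantD(1)[OF inv] ori_boxes by blast
    ultimately show ?thesis by (simp add: s T_def)
  qed
  have fin: "finite T" using finite_boxes finite_edges by (simp add: T_def)
  have "(\<lambda>v. step v (st n v)) \<in> value_space I \<rightarrow>\<^sub>M count_space UNIV"
  proof (rule measurable_compose_countable'[where I = T and f = "\<lambda>s v. step v s" and g = "st n"])
    show "(\<lambda>v. step v s) \<in> value_space I \<rightarrow>\<^sub>M count_space UNIV" if "s \<in> T" for s
      using that step_measurable by (cases s) (simp add: T_def del: descending_step.simps)
    show "st n \<in> value_space I \<rightarrow>\<^sub>M count_space T"
      using Suc fin T by (rule measurable_count_space_subset)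
    show "countable T" using fin by (rule countable_finite)
  qed
  then show ?case by (simp del: descending_step.simps)
qed

sublocale exploration I \<sigma>1 \<sigma>2 "\<lambda>n v. fst (st n v)" "3 * card (edges I)"
  "\<lambda>v. snd (snd (st (3 * card (edges I)) v))"
proof
  show "fst (st 0 v) = {}" for v by simp
  show "fst (st n v) \<subseteq> fst (st (Suc n) v)" for n v
    using step_mono by simp
  show "\<exists>b. fst (st (Suc n) v) \<subseteq> insert b (fst (st n v))" for n v
    by (cases "st n v") (auto simp: Let_def simp del: advance.simps split_paired_Ex intro: advance_single)
  show "fst (st (Suc n) v') = fst (st (Suc n) v)" if "\<And>b. b \<in> fst (st n v) \<Longrightarrow> v' b = v b" for n v v'
    using st_cong[of n v v'] that by metis
  show "Measurable.pred (value_space I) (\<lambda>v. b \<in> fst (st n v))" for b n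
    by (rule measurable_compose[OF st_measurable, where g = "\<lambda>x. b \<in> fst x"]) simp
  show "Measurable.pred (value_space I) (\<lambda>v. e \<in> snd (snd (st (3 * card (edges I)) v)))" for e
    by (rule measurable_compose[OF st_measurable, where g = "\<lambda>x. e \<in> snd (snd x)"]) simp
  show "(i, j) \<in> fst (st (3 * card (edges I)) v)"
    if "{i, j} \<in> snd (snd (st (3 * card (edges I)) v))" for i j v
  proof -
    obtain B S M where s: "st (3 * card (edges I)) v = (B, S, M)" by (cases "st (3 * card (edges I)) v")
    have "edge (i, j) \<in> M" using that by (simp add: s)
    then obtain a where "edge (i, j) = edge a" "a \<in> B" "prod.swap a \<in> B"
      using invariantD(3)[OF invariant_st[of v "3 * card (edges I)", unfolded s]] by blast
    then show ?thesis unfolding edge_eq_iff s by auto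
  qed
qed

text \<open>By the invariant, the reverse of an oriented box is open only together with that box.
  Were it opened first, one step would have opened two boxes.\<close>

lemma not_first_outside:
  assumes "a \<in> boxes I" "a \<notin> ori" shows "\<not> first a v"
proof
  assume "first a v"
  then obtain n where n: "prod.swap a \<notin> fst (st n v)" "a \<in> fst (st (Suc n) v)" "a \<notin> fst (st n v)"
    by (auto simp: first_def simp del: st_Suc)
  obtain B S M where s: "st (Suc n) v = (B, S, M)" by (cases "st (Suc n) v")
  note inv = invariant_st[of v "Suc n", unfolded s]
  have "a \<in> B" using n(2) s by simp
  then have "prod.swap a \<in> ori" using invariantD(2)[OF inv] assms(2) by blast
  then have "prod.swap a \<in> B"
    using invariantD(5)[OF inv] \<open>a \<in> B\<close> by (metis swap_swap)
  obtain b where b: "B \<subseteq> insert b (fst (st n v))"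
    using B_single[of n v] unfolding s fst_conv by blast
  have "a = b" using b n(3) \<open>a \<in> B\<close> by blast
  moreover have "prod.swap a = b" using b n(1) \<open>prod.swap a \<in> B\<close> by blast
  ultimately show False using swap_neq[OF assms(1)] by simp
qed

section \<open>The final state and the welfare for a fixed orientation\<close>

abbreviation out :: "('v pbox \<Rightarrow> real) \<Rightarrow> 'v set set" where
  "out v \<equiv> snd (snd (st (3 * card (edges I)) v))"

lemma matched_iff:
  assumes a: "a \<in> boxes I" shows "matched a v \<longleftrightarrow> a \<in> ori \<and> edge a \<in> out v"
proof
  assume "matched a v"
  then show "a \<in> ori \<and> edge a \<in> out v"
    using not_first_outside[OF a] unfolding matched_def by blast
next
  assume *: "a \<in> ori \<and> edge a \<in> out v"
  then have "a \<in> fst (st (3 * card (edges I)) v)"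
    using M_open[of "fst a" "snd a" v] by (simp only: prod.collapse)
  then have "first a v \<or> first (prod.swap a) v" using opened_first by blast
  moreover have "\<not> first (prod.swap a) v"
    using * a ori_swap by (intro not_first_outside) simp_all
  ultimately show "matched a v" using * unfolding matched_def by blast
qed

lemma sum_matched:
  "(\<Sum>a\<in>boxes I. of_bool (matched a v) * k1 a v) = (\<Sum>a\<in>ori. of_bool (edge a \<in> out v) * k1 a v)"
  using sum_of_bool_subset[OF finite_boxes ori_boxes, of "\<lambda>a. of_bool (edge a \<in> out v) * k1 a v"]
  by (simp add: matched_iff of_bool_conj mult.assoc)

text \<open>At the end all remaining indices are negative. An exposed basket would still remain,
  with an index above one it has passed, which was nonnegative when the basket was advanced.\<close>

lemma never_exposed:
  assumes a: "a \<in> boxes I"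
  shows "first a v \<Longrightarrow> d1 a v > 0 \<Longrightarrow> edge a \<in> out v"
    and "both a v \<Longrightarrow> d2 a v > 0 \<Longrightarrow> edge a \<in> out v"
proof -
  obtain B S M where s: "st (3 * card (edges I)) v = (B, S, M)"
    by (cases "st (3 * card (edges I)) v")
  have stop: "\<forall>a\<in>S. cur v B a < 0" using stopped_final[of v] by (simp add: s stopped_def)
  note inv = invariant_st[of v "3 * card (edges I)", unfolded s]
  note i = invariantD(4,5,7,8)[OF inv]
  have f: "a \<in> ori \<and> a \<in> B" if "first a v"
    using that not_first_outside[OF a, of v] first_opened[of a v] by (auto simp: s)
  show "edge a \<in> out v" if 1: "first a v" "d1 a v > 0"
  proof (rule ccontr)
    assume "edge a \<notin> out v"
    moreover have x: "\<sigma>1 a < K2 a v" using excess_posD 1(2) by (simp add: d1_def)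
    ultimately have "a \<in> S" using i(3) f[OF 1(1)] by (auto simp: s)
    moreover have "0 \<le> \<sigma>1 a" "\<sigma>1 a < cur v B a"
      using x i(1) f[OF 1(1)] by (auto simp: cur_eq K2_def)
    ultimately show False using stop by force
  qed
  show "edge a \<in> out v" if 2: "both a v" "d2 a v > 0"
  proof (rule ccontr)
    have b: "prod.swap a \<in> B" "a \<in> ori" "a \<in> B" using 2(1) f by (auto simp: both_def s)
    assume "edge a \<notin> out v"
    moreover have x: "\<sigma>2 a (v a) < ereal (k3 a v)" using excess_posD 2(2) by (simp add: d2_def)
    ultimately have "a \<in> S" using i(4) b by (auto simp: s)
    moreover have "0 \<le> \<sigma>2 a (v a)" "\<sigma>2 a (v a) < cur v B a"
      using x i(2) b by (auto simp: cur_eq)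
    ultimately show False using stop by force
  qed
qed

lemma descending_procedure_eq:
  "descending_procedure I tie \<sigma>1 \<sigma>2 ori v = (fst (st (3 * card (edges I)) v), out v)"
  by (simp add: descending_procedure_def st_def case_prod_unfold)

lemma descending_welfare:
  "(\<integral>v. net_value I v (descending_procedure I tie \<sigma>1 \<sigma>2 ori v) \<partial>value_space I) =
    (\<integral>v. (\<Sum>a\<in>ori. of_bool (edge a \<in> out v) * k1 a v) \<partial>value_space I)"
  unfolding descending_procedure_eq sum_matched[symmetric]
  using never_exposed by (intro welfare_eq) auto

text \<open>A basket left at the end has a negative index and hence a negative \<open>K1\<close>.
  One with nonnegative \<open>k1\<close> has therefore been removed, and the invariant provides the
  matched basket that dominates it.\<close>

lemma greedy_k1:
  assumes v: "\<forall>a\<in>boxes I. \<sigma>2 a (v a) \<noteq> -\<infinity>"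
  shows "a \<in> ori \<Longrightarrow> edge a \<in> out v \<Longrightarrow> 0 \<le> k1 a v"
    and "b \<in> ori \<Longrightarrow> 0 \<le> k1 b v \<Longrightarrow>
      \<exists>a\<in>ori. edge a \<in> out v \<and> edge a \<inter> edge b \<noteq> {} \<and> k1 b v \<le> k1 a v"
proof -
  obtain B S M where s: "st (3 * card (edges I)) v = (B, S, M)"
    by (cases "st (3 * card (edges I)) v")
  have stop: "\<forall>a\<in>S. cur v B a < 0" using stopped_final[of v] by (simp add: s stopped_def)
  note i = invariantD(3,6)[OF invariant_st[of v "3 * card (edges I)", unfolded s]]
  have k: "K1 a v = ereal (k1 a v)" if "a \<in> ori" for a
    using that v ori_boxes by (intro k1_eq_K1[symmetric]) auto
  show "0 \<le> k1 a v" if a: "a \<in> ori" "edge a \<in> out v"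
  proof -
    obtain a' where a': "a' \<in> ori" "edge a = edge a'" "0 \<le> K1 a' v" using i(1) a(2) by (auto simp: s)
    then have "a = a'" using a(1) ori_swap[of a'] unfolding edge_eq_iff by auto
    then show ?thesis using a' k by simp
  qed
  show "\<exists>a\<in>ori. edge a \<in> out v \<and> edge a \<inter> edge b \<noteq> {} \<and> k1 b v \<le> k1 a v"
    if b: "b \<in> ori" "0 \<le> k1 b v"
  proof -
    have "b \<notin> S" 
    proof
      assume "b \<in> S"
      then have "K1 b v < 0" using stop K1_le_cur[of b v B] by (auto intro: le_less_trans)
      then show False using b k by simp
    qed
    then obtain a where "a \<in> ori" "edge a \<in> M" "edge a \<inter> edge b \<noteq> {}" "K1 b v \<le> K1 a v"
      using i(2) b(1) by blast
    then show ?thesis using k b(1) by (intro bexI[of _ a]) (auto simp: s)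
  qed
qed

lemma descending_welfare_nonneg:
  "0 \<le> (\<integral>v. net_value I v (descending_procedure I tie \<sigma>1 \<sigma>2 ori v) \<partial>value_space I)"
  unfolding descending_welfare
proof (rule integral_nonneg_AE)
  show "AE v in value_space I. 0 \<le> (\<Sum>a\<in>ori. of_bool (edge a \<in> out v) * k1 a v)"
    using AE_\<sigma>2_not_MInfty
    by eventually_elim (auto intro!: sum_nonneg simp: greedy_k1)
qed

text \<open>The comparison is made for each value vector separately, so \<open>M'\<close> may depend
  on all values. Summing over all boxes with an indicator confines the orientation to the
  coefficients on the left, ready for averaging.\<close>

lemma descending_welfare_ge:
  assumes M': "\<And>v. matching I (M' v)"
    and [measurable]: "\<And>e. Measurable.pred (value_space I) (\<lambda>v. e \<in> M' v)"
  shows "(\<Sum>a\<in>boxes I. of_bool (a \<in> ori) * (\<integral>v. of_bool (edge a \<in> M' v) * max 0 (k1 a v) \<partial>value_space I))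
    \<le> 2 * (\<integral>v. net_value I v (descending_procedure I tie \<sigma>1 \<sigma>2 ori v) \<partial>value_space I)"
proof -
  have o: "\<And>a. a \<in> ori \<Longrightarrow> a \<in> boxes I" using ori_boxes by auto
  have int: "integrable (value_space I) (\<lambda>v. of_bool (edge a \<in> M' v) * max 0 (k1 a v))"
    if "a \<in> ori" for a
    using integrable_k1[OF o[OF that]] by (intro integrable_of_bool_mult) auto
  have int': "integrable (value_space I) (\<lambda>v. of_bool (edge a \<in> out v) * k1 a v)"
    if "a \<in> ori" for a
    using integrable_k1[OF o[OF that]] M_measurable by (intro integrable_of_bool_mult) auto
  have "(\<Sum>a\<in>boxes I. of_bool (a \<in> ori) * (\<integral>v. of_bool (edge a \<in> M' v) * max 0 (k1 a v) \<partial>value_space I)) =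
     (\<Sum>a\<in>ori. (\<integral>v. of_bool (edge a \<in> M' v) * max 0 (k1 a v) \<partial>value_space I))"
    using finite_boxes ori_boxes by (rule sum_of_bool_subset)
  also have "\<dots> = (\<integral>v. (\<Sum>a\<in>ori. of_bool (edge a \<in> M' v) * max 0 (k1 a v)) \<partial>value_space I)"
    using int by simp
  also have "\<dots> \<le> (\<integral>v. 2 * (\<Sum>a\<in>ori. of_bool (edge a \<in> out v) * k1 a v) \<partial>value_space I)"
  proof (rule integral_mono_AE)
    show "AE v in value_space I. (\<Sum>a\<in>ori. of_bool (edge a \<in> M' v) * max 0 (k1 a v)) \<le>
        2 * (\<Sum>a\<in>ori. of_bool (edge a \<in> out v) * k1 a v)"
      using AE_\<sigma>2_not_MInfty
    proof eventually_elim
      case (elim v)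
      show ?case
        by (rule greedy_half_optimal[OF finite_ori ori_swap _ greedy_k1[OF elim]])
          (use M'[of v] in \<open>simp_all add: matching_def\<close>)
    qed
  qed (use int int' in \<open>auto intro!: Bochner_Integration.integrable_sum\<close>)
  finally show ?thesis unfolding descending_welfare by simp
qed

end

section \<open>Random orientations\<close>

context pandora_indices
begin

lemma edge_orientations:
  assumes "e \<in> edges I"
  shows "finite {(i, j). {i, j} = e}" "card {(i, j). {i, j} = e} = 2" "{(i, j). {i, j} = e} \<noteq> {}"
proof -
  obtain x y where e: "e = {x, y}" "x \<noteq> y"
    using assms inst by (auto simp: pandora_instance_def card_2_iff)
  then have *: "{(i, j). {i, j} = e} = {(x, y), (y, x)}" by (auto simp: doubleton_eq_iff)
  show "finite {(i, j). {i, j} = e}" "card {(i, j). {i, j} = e} = 2" "{(i, j). {i, j} = e} \<noteq> {}"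
    unfolding * using e by simp_all
qed

lemma orientation_choice:
  assumes "f \<in> set_pmf (Pi_pmf (edges I) undefined (\<lambda>e. pmf_of_set {(i, j). {i, j} = e}))"
    and e: "e \<in> edges I"
  shows "edge (f e) = e"
proof -
  note * = set_pmf_of_set[OF edge_orientations(3,1)[OF e]]
  have "f e \<in> set_pmf (pmf_of_set {(i, j). {i, j} = e})"
    using assms finite_edges by (auto simp: set_Pi_pmf PiE_dflt_def)
  then show ?thesis unfolding * by (simp add: case_prod_unfold)
qed

lemma random_orientation_descent:
  assumes "ori \<in> set_pmf (random_orientation I)" "tie_breaking tie"
  shows "descent I \<sigma>1 \<sigma>2 tie ori"
proof
  obtain f where f: "f \<in> set_pmf (Pi_pmf (edges I) undefined (\<lambda>e. pmf_of_set {(i, j). {i, j} = e}))"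
    and ori: "ori = f ` edges I"
    using assms(1) by (auto simp: random_orientation_def)
  note edge = orientation_choice[OF f]
  show "ori \<subseteq> boxes I"
  proof
    fix a assume "a \<in> ori"
    then obtain e where "e \<in> edges I" "a = f e" by (auto simp: ori)
    then show "a \<in> boxes I" using edge[of e] by (simp add: boxes_def case_prod_unfold)
  qed
  then show "prod.swap a \<notin> ori" if "a \<in> ori" for a
  proof -
    obtain e where e: "e \<in> edges I" "a = f e" using \<open>a \<in> ori\<close> by (auto simp: ori)
    have "prod.swap a \<noteq> f e'" if "e' \<in> edges I" for e'
    proof
      assume "prod.swap a = f e'"
      then have "e' = edge (prod.swap a)" using edge[OF that] by simp
      also have "\<dots> = edge a" by (simp add: insert_commute)
      also have "\<dots> = e" using edge[OF e(1)] e(2) by simp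
      finally have "e' = e" .
      then show False
        using \<open>prod.swap a = f e'\<close> e(2) swap_neq[of a] \<open>ori \<subseteq> boxes I\<close> \<open>a \<in> ori\<close> by auto
    qed
    then show ?thesis by (auto simp: ori)
  qed
  show "card ori \<le> card (edges I)" unfolding ori using finite_edges by (rule card_image_le)
  show "tie_breaking tie" by fact
qed

lemma prob_orientation:
  assumes a: "a \<in> boxes I"
  shows "measure_pmf.prob (random_orientation I) {ori. a \<in> ori} = 1 / 2"
proof -
  let ?P = "Pi_pmf (edges I) undefined (\<lambda>e. pmf_of_set {(i, j). {i, j} = e})"
  have e: "edge a \<in> edges I" using a by (simp add: boxes_def case_prod_unfold)
  note o = edge_orientations[OF e]
  have "measure_pmf.prob (random_orientation I) {ori. a \<in> ori} =
      measure_pmf.prob ?P {f. a \<in> f ` edges I}"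
    by (simp add: random_orientation_def vimage_def)
  \<comment> \<open>Each choice on the support orients its own edge, so \<open>a\<close> can only be
    the choice made at \<open>edge a\<close>. A single component of the product remains, uniform on
    two pairs.\<close>
  also have "\<dots> = measure_pmf.prob ?P {f. f (edge a) = a}"
  proof (rule measure_pmf.finite_measure_eq_AE)
    have "a \<in> f ` edges I \<longleftrightarrow> f (edge a) = a" if "f \<in> set_pmf ?P" for f
      using orientation_choice[OF that] e by (metis image_iff)
    then show "AE f in measure_pmf ?P. f \<in> {f. a \<in> f ` edges I} \<longleftrightarrow> f \<in> {f. f (edge a) = a}"
      by (simp add: AE_measure_pmf_iff)
  qed auto
  also have "\<dots> = measure_pmf.prob (map_pmf (\<lambda>f. f (edge a)) ?P) {a}"
    by (simp add: vimage_def)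
  also have "map_pmf (\<lambda>f. f (edge a)) ?P = pmf_of_set {(i, j). {i, j} = edge a}"
    unfolding Pi_pmf_component[OF finite_edges] if_P[OF e] ..
  also have "measure_pmf.prob (pmf_of_set {(i, j). {i, j} = edge a}) {a} = 1 / 2"
    unfolding measure_pmf_single pmf_of_set[OF o(3,1)] o(2) by (simp add: case_prod_unfold)
  finally show ?thesis .
qed

lemma finite_random_orientation: "finite (set_pmf (random_orientation I))"
proof (rule finite_subset)
  show "set_pmf (random_orientation I) \<subseteq> (\<lambda>f. f ` edges I) `
      set_pmf (Pi_pmf (edges I) undefined (\<lambda>e. pmf_of_set {(i, j). {i, j} = e}))"
    by (simp add: random_orientation_def)
  have "finite (set_pmf (pmf_of_set {(i, j). {i, j} = e}))" if "e \<in> edges I" for e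
    unfolding set_pmf_of_set[OF edge_orientations(3,1)[OF that]] by (rule edge_orientations(1)[OF that])
  then show "finite ((\<lambda>f. f ` edges I) `
      set_pmf (Pi_pmf (edges I) undefined (\<lambda>e. pmf_of_set {(i, j). {i, j} = e})))"
    using finite_edges by (intro finite_imageI) (auto simp: set_Pi_pmf intro!: finite_PiE_dflt)
qed

text \<open>Needed for algorithms whose welfare integral over the internal randomness does not exist
  and is 0 by convention.\<close>

lemma randomized_welfare_nonneg:
  assumes "tie_breaking tie"
  shows "0 \<le> randomized_welfare I tie \<sigma>1 \<sigma>2"
  unfolding randomized_welfare_def welfare_def
proof (rule integral_nonneg_AE)
  show "AE ori in measure_pmf (random_orientation I).
      0 \<le> (\<integral>v. net_value I v (descending_procedure I tie \<sigma>1 \<sigma>2 ori v) \<partial>value_space I)"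
    using descent.descending_welfare_nonneg[OF random_orientation_descent[OF _ assms]]
    by (simp add: AE_measure_pmf_iff)
qed

end

section \<open>Averaging over orientations and the final bound\<close>

lemma (in pandora_policy) policy_welfare_le:
  assumes tie: "tie_breaking tie"
  shows "(\<integral>v. net_value I v (execute I p v) \<partial>value_space I) \<le> 4 * randomized_welfare I tie \<sigma>1 \<sigma>2"
proof -
  let ?O = "random_orientation I"
  let ?g = "\<lambda>ori. \<integral>v. net_value I v (descending_procedure I tie \<sigma>1 \<sigma>2 ori v) \<partial>value_space I"
  \<comment> \<open>The share of the ordered pair \<open>a\<close> in the bound of
    \<open>welfare_le\<close>. It depends on the policy but not on the orientation, so averaging its
    indicator multiplies it by 1/2.\<close>
  define t where
    "t a = (\<integral>v. of_bool (edge a \<in> snd (execute I p v)) * max 0 (k1 a v) \<partial>value_space I)" for a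
  have fin: "integrable (measure_pmf ?O) h" for h :: "_ \<Rightarrow> real"
    by (rule integrable_measure_pmf_finite[OF finite_random_orientation])
  have half: "(\<integral>ori. of_bool (a \<in> ori) * t a \<partial>measure_pmf ?O) = t a / 2" if "a \<in> boxes I" for a
  proof -
    have "(\<integral>ori. of_bool (a \<in> ori) * t a \<partial>measure_pmf ?O) =
        (\<integral>ori. indicator {ori. a \<in> ori} ori * t a \<partial>measure_pmf ?O)"
      by (intro Bochner_Integration.integral_cong) (auto simp: indicator_def)
    then show ?thesis using prob_orientation[OF that] by simp
  qed
  have "(\<Sum>a\<in>boxes I. t a) / 2 = (\<Sum>a\<in>boxes I. \<integral>ori. of_bool (a \<in> ori) * t a \<partial>measure_pmf ?O)"
    unfolding sum_divide_distrib by (intro sum.cong refl half[symmetric])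
  also have "\<dots> = (\<integral>ori. (\<Sum>a\<in>boxes I. of_bool (a \<in> ori) * t a) \<partial>measure_pmf ?O)"
    using fin by (intro Bochner_Integration.integral_sum[symmetric])
  also have "\<dots> \<le> (\<integral>ori. 2 * ?g ori \<partial>measure_pmf ?O)"
  proof (rule integral_mono_AE[OF fin fin])
    have "(\<Sum>a\<in>boxes I. of_bool (a \<in> ori) * t a) \<le> 2 * ?g ori" if "ori \<in> set_pmf ?O" for ori
      unfolding t_def
      by (rule descent.descending_welfare_ge[OF random_orientation_descent[OF that tie]
          matching_execute M_measurable])
    then show "AE ori in measure_pmf ?O. (\<Sum>a\<in>boxes I. of_bool (a \<in> ori) * t a) \<le> 2 * ?g ori"
      by (simp add: AE_measure_pmf_iff)
  qed
  also have "\<dots> = 2 * randomized_welfare I tie \<sigma>1 \<sigma>2"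
    by (simp add: randomized_welfare_def welfare_def)
  \<comment> \<open>The constant 4 is the product of the 2 from the greedy comparison and the 2 from
    the probability 1/2.\<close>
  finally have "(\<Sum>a\<in>boxes I. t a) \<le> 4 * randomized_welfare I tie \<sigma>1 \<sigma>2" by simp
  moreover have "(\<integral>v. net_value I v (execute I p v) \<partial>value_space I) \<le> (\<Sum>a\<in>boxes I. t a)"
    using welfare_le unfolding t_def execute_def[symmetric] prod.collapse .
  ultimately show ?thesis by simp
qed

text \<open>Joint measurability passes to sections, so each value of the internal randomness yields
  a policy to which the bound applies.\<close>

lemma algorithm_policy:
  fixes I :: "'v pandora"
  assumes "pandora_instance I" "nested_indices I \<sigma>1 \<sigma>2" "algorithm I R \<pi>" "r \<in> space R"
  shows "pandora_policy I \<sigma>1 \<sigma>2 (\<pi> r)"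
proof
  fix h :: "'v history" assume "distinct (map fst h)" "fst ` set h \<subseteq> boxes I"
  then show "valid_action I (fst ` set h) (\<pi> r h)" using assms(3,4) unfolding algorithm_def by blast
next
  fix bs assume "distinct bs" "set bs \<subseteq> boxes I"
  then have "(\<lambda>(r, v). \<pi> r (map (\<lambda>b. (b, v b)) bs)) \<in> R \<Otimes>\<^sub>M value_space I \<rightarrow>\<^sub>M count_space UNIV"
    using assms(3) unfolding algorithm_def by blast
  from measurable_compose[OF measurable_Pair1'[OF assms(4)] this]
  show "(\<lambda>v. \<pi> r (map (\<lambda>b. (b, v b)) bs)) \<in> value_space I \<rightarrow>\<^sub>M count_space UNIV" by simp
qed fact+

theorem theorem1:
  fixes I :: "'v pandora"
    and \<sigma>1 :: "'v pbox \<Rightarrow> ereal" and \<sigma>2 :: "'v pbox \<Rightarrow> real \<Rightarrow> ereal"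
    and tie :: "'v state \<Rightarrow> 'v pbox set \<Rightarrow> 'v pbox"
  assumes "pandora_instance I"
    and "nested_indices I \<sigma>1 \<sigma>2"
    and "tie_breaking tie"
  shows "ereal (randomized_welfare I tie \<sigma>1 \<sigma>2) \<ge> ereal (1 / 4) * opt_welfare TYPE('r) I"
proof -
  let ?W = "randomized_welfare I tie \<sigma>1 \<sigma>2"
  interpret pandora_indices I \<sigma>1 \<sigma>2 using assms(1,2) by unfold_locales
  have "welfare I R (\<lambda>r. execute I (\<pi> r)) \<le> 4 * ?W"
    if alg: "algorithm I R \<pi>" for R :: "'r measure" and \<pi>
  proof -
    let ?w = "\<lambda>r. \<integral>v. net_value I v (execute I (\<pi> r) v) \<partial>value_space I"
    interpret R: prob_space R using alg by (simp add: algorithm_def)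
    have le: "?w r \<le> 4 * ?W" if "r \<in> space R" for r
      by (rule pandora_policy.policy_welfare_le[OF algorithm_policy[OF assms(1,2) alg that] assms(3)])
    show ?thesis
    proof (cases "integrable R ?w")
      case True
      then show ?thesis unfolding welfare_def using le by (intro R.integral_le_const) auto
    next
      \<comment> \<open>The Bochner integral is then 0, and the bound reduces to nonnegativity of
        the randomized welfare.\<close>
      case False
      then show ?thesis unfolding welfare_def
        using randomized_welfare_nonneg[OF assms(3)] by (simp add: not_integrable_integral_eq)
    qed
  qed
  then have "opt_welfare TYPE('r) I \<le> ereal (4 * ?W)"
    unfolding opt_welfare_def by (intro SUP_least) auto
  then have "ereal (1 / 4) * opt_welfare TYPE('r) I \<le> ereal (1 / 4) * ereal (4 * ?W)"
    by (intro ereal_mult_left_mono) auto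
  then show ?thesis by simp
qed

end
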